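(* There is a universal constant $C>0$ such that the following holds. Let $d\ge 1$ and $L\ge 3$ be integers, let $G=\mathbf{Z}^d/L\mathbf{Z}^d$, let $r\ge 1$ be an integer and let $\rho=r/L^d$. Then the relaxation time $\tau_1$ of the zero range process with rate $1$ on $G$ with $r$ particles satisfies $$\tau_1\le C\,d^2(\rho+1)^2L^2 .$$ *)

theory Defs
  imports Complex_Main
begin

text \<open>Discrete torus G = Z^d / L Z^d. A site is represented canonically as a
function x :: nat => nat with x i < L for i < d and x i = 0 for i >= d.\<close>

definition torus :: "nat \<Rightarrow> nat \<Rightarrow> (nat \<Rightarrow> nat) set" where
  "torus d L = {x. (\<forall>i<d. x i < L) \<and> (\<forall>i. d \<le> i \<longrightarrow> x i = 0)}"

definition nbr :: "nat \<Rightarrow> (nat \<Rightarrow> nat) \<Rightarrow> nat \<Rightarrow> bool \<Rightarrow> (nat \<Rightarrow> nat)" where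
  "nbr L x i b = x(i := (if b then (x i + 1) mod L else (x i + L - 1) mod L))"

definition zrp_configs :: "nat \<Rightarrow> nat \<Rightarrow> nat \<Rightarrow> ((nat \<Rightarrow> nat) \<Rightarrow> nat) set" where
  "zrp_configs d L r = {\<eta>. (\<forall>x. x \<notin> torus d L \<longrightarrow> \<eta> x = 0) \<and> (\<Sum>x\<in>torus d L. \<eta> x) = r}"

definition move :: "((nat \<Rightarrow> nat) \<Rightarrow> nat) \<Rightarrow> (nat \<Rightarrow> nat) \<Rightarrow> (nat \<Rightarrow> nat) \<Rightarrow> ((nat \<Rightarrow> nat) \<Rightarrow> nat)" where
  "move \<eta> x y = \<eta>(x := \<eta> x - 1, y := \<eta> y + 1)"

text \<open>Stationary (reversible) measure: for rate g = 1 the ZRP invariant measure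
on configurations with r particles is uniform.\<close>

definition zrp_pi :: "nat \<Rightarrow> nat \<Rightarrow> nat \<Rightarrow> ((nat \<Rightarrow> nat) \<Rightarrow> nat) \<Rightarrow> real" where
  "zrp_pi d L r \<eta> = 1 / real (card (zrp_configs d L r))"

text \<open>Dirichlet form of the zero range process with rate 1: every occupied site
emits a particle at rate 1, which jumps to one of the 2d neighbours chosen
uniformly (simple random walk kernel p(x,y) = 1/(2d)).\<close>

definition zrp_dirichlet :: "nat \<Rightarrow> nat \<Rightarrow> nat \<Rightarrow> (((nat \<Rightarrow> nat) \<Rightarrow> nat) \<Rightarrow> real) \<Rightarrow> real" where
  "zrp_dirichlet d L r f =
     (1/2) * (\<Sum>\<eta>\<in>zrp_configs d L r. zrp_pi d L r \<eta> *
        (\<Sum>x\<in>torus d L. if 1 \<le> \<eta> x then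
            (\<Sum>i<d. \<Sum>b\<in>(UNIV::bool set).
               (1 / (2 * real d)) * (f (move \<eta> x (nbr L x i b)) - f \<eta>)\<^sup>2)
          else 0))"

definition zrp_mean :: "nat \<Rightarrow> nat \<Rightarrow> nat \<Rightarrow> (((nat \<Rightarrow> nat) \<Rightarrow> nat) \<Rightarrow> real) \<Rightarrow> real" where
  "zrp_mean d L r f = (\<Sum>\<eta>\<in>zrp_configs d L r. zrp_pi d L r \<eta> * f \<eta>)"

definition zrp_var :: "nat \<Rightarrow> nat \<Rightarrow> nat \<Rightarrow> (((nat \<Rightarrow> nat) \<Rightarrow> nat) \<Rightarrow> real) \<Rightarrow> real" where
  "zrp_var d L r f =
     (\<Sum>\<eta>\<in>zrp_configs d L r. zrp_pi d L r \<eta> * (f \<eta> - zrp_mean d L r f)\<^sup>2)"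

definition zrp_gap :: "nat \<Rightarrow> nat \<Rightarrow> nat \<Rightarrow> real" where
  "zrp_gap d L r = Inf {zrp_dirichlet d L r f / zrp_var d L r f | f. zrp_var d L r f \<noteq> 0}"

definition zrp_relax_time :: "nat \<Rightarrow> nat \<Rightarrow> nat \<Rightarrow> real" where
  "zrp_relax_time d L r = 1 / zrp_gap d L r"

end

theory Submission
  imports Defs "HOL-Analysis.Convex" "HOL-Library.Function_Algebras"
begin

text \<open>Write the uniform measure on configurations with \<open>r\<close> particles on \<open>n\<close> sites in terms of
  \<open>\<xi>\<close> with \<open>r - 1\<close> particles: one particle jumping from \<open>x\<close> to \<open>y\<close> replaces \<open>\<xi> + \<delta>\<^sub>x\<close> by
  \<open>\<xi> + \<delta>\<^sub>y\<close>, so for each \<open>\<xi>\<close> the Dirichlet form is that of a random walk on the graph, and the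
  Poincare inequality on the torus reduces the claim to the complete graph with constant
  \<open>C (\<rho> + 1)\<^sup>2\<close>.

  On the complete graph, the correlation operator \<open>P\<close> of two sites satisfies
  \<open>- 1 / (n - 1) \<le> P \<le> 2 / (n (n - 1))\<close> on mean-zero functions. Conditioning on a random site and
  induction on \<open>n\<close> then bound the variance by \<open>3 / (n + 1)\<close> times the sum over pairs of
  the expected conditional variances given the configuration off the pair.

  A pair of sites carrying less than \<open>2 M\<close> particles, where \<open>M\<close> is of order \<open>\<rho> + 1\<close>, is
  resampled along a path of length at most \<open>2 M\<close>. A pair carrying at least \<open>2 M\<close> particles dumps
  a block of \<open>M\<close> of them on a third site \<open>u\<close>. After the dump \<open>u\<close> carries at least \<open>M\<close> particles,
  and by Markov's inequality only a small fraction of the sites do, so the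
  conditional variance that remains is absorbed in the left-hand side.\<close>

section \<open>Counting multisets and the one-site averaging operator\<close>

text \<open>Log-convexity makes the ratios of consecutive terms nondecreasing, so a first ratio
  \<open>p > q\<close> would force growth at least like \<open>p ^ k\<close>, against the bound. For
  norms of iterates of a self-adjoint operator this upgrades a decay rate with an arbitrary constant
  \<open>C\<close> to a one-step estimate.\<close>

lemma log_convex_growth:
  fixes a :: "nat \<Rightarrow> real"
  assumes nonneg: "\<And>k. a k \<ge> 0" and conv: "\<And>k. (a (Suc k))\<^sup>2 \<le> a k * a (Suc (Suc k))"
    and bound: "\<And>k. a k \<le> C * q ^ k" and q: "q > 0"
  shows "a 1 \<le> q * a 0"
proof (rule ccontr)
  assume "\<not> ?thesis"
  then have gt: "a 1 > q * a 0" by simp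
  have a0: "a 0 > 0"
  proof (rule ccontr)
    assume "\<not> a 0 > 0"
    then have "a 0 = 0" using nonneg[of 0] by simp
    then show False using conv[of 0] gt by simp
  qed
  define p where "p = a 1 / a 0"
  have pq: "p > q" unfolding p_def using gt a0 by (simp add: field_simps)
  have step: "a k > 0 \<and> a (Suc k) \<ge> p * a k" for k
  proof (induction k)
    case 0
    then show ?case using a0 by (simp add: p_def)
  next
    case (Suc k)
    have p0: "p > 0" using pq q by simp
    have pos: "a (Suc k) > 0" using Suc p0 mult_pos_pos[of p "a k"] by linarith
    have "a k * (p * a (Suc k)) \<le> (a (Suc k))\<^sup>2"
      using mult_right_mono[of "p * a k" "a (Suc k)" "a (Suc k)"] Suc pos
      by (simp add: power2_eq_square mult_ac)
    also have "\<dots> \<le> a k * a (Suc (Suc k))" by (rule conv)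
    finally show ?case using Suc pos by simp
  qed
  have geo: "a k \<ge> a 0 * p ^ k" for k
  proof (induction k)
    case (Suc k)
    have "a 0 * p ^ Suc k = p * (a 0 * p ^ k)" by simp
    also have "\<dots> \<le> p * a k" using Suc pq q by (intro mult_left_mono) auto
    finally show ?case using step[of k] by linarith
  qed simp
  have "1 < p / q" using pq q by simp
  then obtain k where k: "C / a 0 < (p / q) ^ k" using real_arch_pow by blast
  have "a 0 * p ^ k \<le> C * q ^ k" using geo[of k] bound[of k] by linarith
  then have "(p / q) ^ k \<le> C / a 0" using a0 q by (simp add: field_simps)
  then show False using k by simp
qed

text \<open>\<open>mc a j\<close> counts the multisets of size \<open>j\<close> over \<open>a\<close> letters; truncated subtraction
  makes the value right for \<open>a = 0\<close> as well.\<close>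

definition mc :: "nat \<Rightarrow> nat \<Rightarrow> real" where
  "mc a j = real ((j + a - 1) choose j)"

lemma mc_0_right [simp]: "mc a 0 = 1"
  by (simp add: mc_def)

lemma mc_1_left [simp]: "mc (Suc 0) j = 1"
  by (simp add: mc_def)

lemma mc_nonneg [simp]: "mc a j \<ge> 0"
  by (simp add: mc_def)

lemma mc_pos: "a > 0 \<Longrightarrow> mc a j > 0"
  by (simp add: mc_def)

lemma mc_Suc_right: "real (Suc j) * mc a (Suc j) = real (j + a) * mc a j"
proof (cases a)
  case 0
  then show ?thesis by (cases j) (auto simp: mc_def binomial_eq_0 simp del: binomial_Suc_Suc)
next
  case (Suc b)
  have "Suc j * (Suc (j + b) choose Suc j) = Suc (j + b) * ((j + b) choose j)"
    using Suc_times_binomial_eq[of "j + b" j] by (simp add: mult.commute)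
  then show ?thesis using Suc unfolding mc_def by (metis Suc_diff_1 add_Suc add_Suc_right diff_Suc_1 of_nat_mult)
qed

lemma mc_Suc_left: "real a * mc (Suc a) j = real (j + a) * mc a j"
proof -
  have "a * ((j + a) choose j) = (j + a) * ((j + a - 1) choose j)"
    using binomial_absorb_comp[of "j + a" j] by simp
  then show ?thesis unfolding mc_def by (metis add_Suc_right diff_Suc_1 of_nat_mult)
qed

text \<open>Put \<open>m\<close> particles uniformly on \<open>a + b\<close> sites:
  \<open>mconv\<close> is the unnormalised mean of \<open>\<phi>\<close> at the number of particles
  in a fixed block of \<open>a\<close> sites, and \<open>mavg\<close> below is the mean
  itself.\<close>

definition mconv :: "nat \<Rightarrow> nat \<Rightarrow> (nat \<Rightarrow> real) \<Rightarrow> nat \<Rightarrow> real" where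
  "mconv a b \<phi> m = (\<Sum>j\<le>m. \<phi> j * mc a j * mc b (m - j))"

text \<open>Split \<open>Suc m = j + (Suc m - j)\<close> and absorb each factor into its own
  \<open>mc\<close> by \<open>mc_Suc_right\<close>. What is left over is
  \<open>(j + a) * (\<phi> (Suc j) - \<phi> j)\<close>, and \<open>mc_Suc_left\<close> turns its
  factor \<open>j + a\<close> into a block enlarged by one site.\<close>

lemma mconv_step:
  "real (Suc m) * mconv a b \<phi> (Suc m) - real (m + a + b) * mconv a b \<phi> m
     = real a * mconv (Suc a) b (\<lambda>j. \<phi> (Suc j) - \<phi> j) m"
proof -
  have A: "(\<Sum>j\<le>Suc m. real (Suc m - j) * (\<phi> j * mc a j * mc b (Suc m - j)))
     = (\<Sum>j\<le>m. \<phi> j * mc a j * (real (m - j + b) * mc b (m - j)))"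
  proof -
    have "(\<Sum>j\<le>Suc m. real (Suc m - j) * (\<phi> j * mc a j * mc b (Suc m - j)))
      = (\<Sum>j\<le>m. real (Suc m - j) * (\<phi> j * mc a j * mc b (Suc m - j)))" by simp
    also have "\<dots> = (\<Sum>j\<le>m. \<phi> j * mc a j * (real (m - j + b) * mc b (m - j)))"
    proof (rule sum.cong[OF refl])
      fix j assume "j \<in> {..m}"
      then have "Suc m - j = Suc (m - j)" by (simp add: Suc_diff_le)
      then show "real (Suc m - j) * (\<phi> j * mc a j * mc b (Suc m - j)) = \<phi> j * mc a j * (real (m - j + b) * mc b (m - j))"
        unfolding mc_Suc_right[of "m-j" b, symmetric] by (simp only: mult_ac)
    qed
    finally show ?thesis .
  qed
  have B: "(\<Sum>j\<le>Suc m. real j * (\<phi> j * mc a j * mc b (Suc m - j)))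
     = (\<Sum>j\<le>m. \<phi> (Suc j) * (real (j + a) * mc a j) * mc b (m - j))"
    unfolding mc_Suc_right[symmetric] by (subst sum.atMost_Suc_shift) (simp add: mult_ac)
  have "real (Suc m) * mconv a b \<phi> (Suc m) =
     (\<Sum>j\<le>Suc m. real j * (\<phi> j * mc a j * mc b (Suc m - j)) + real (Suc m - j) * (\<phi> j * mc a j * mc b (Suc m - j)))"
    unfolding mconv_def sum_distrib_left
    by (rule sum.cong[OF refl]) (simp add: of_nat_diff algebra_simps del: of_nat_Suc)
  also have "\<dots> = (\<Sum>j\<le>m. \<phi> (Suc j) * (real (j + a) * mc a j) * mc b (m - j))
      + (\<Sum>j\<le>m. \<phi> j * mc a j * (real (m - j + b) * mc b (m - j)))"
    unfolding sum.distrib A B ..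
  finally have C: "real (Suc m) * mconv a b \<phi> (Suc m) = \<dots>" .
  show ?thesis unfolding C unfolding mconv_def sum_distrib_left sum.distrib[symmetric] sum_subtractf[symmetric]
  proof (rule sum.cong[OF refl])
    fix j assume j: "j \<in> {..m}"
    have "real a * ((\<phi> (Suc j) - \<phi> j) * mc (Suc a) j * mc b (m - j))
       = (\<phi> (Suc j) - \<phi> j) * (real (j+a) * mc a j) * mc b (m - j)"
      unfolding mc_Suc_left[symmetric] by simp
    then show "\<phi> (Suc j) * (real (j + a) * mc a j) * mc b (m - j) + \<phi> j * mc a j * (real (m - j + b) * mc b (m - j))
       - real (m + a + b) * (\<phi> j * mc a j * mc b (m - j)) = real a * ((\<phi> (Suc j) - \<phi> j) * mc (Suc a) j * mc b (m - j))"
      using j by (simp add: algebra_simps)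
  qed
qed

lemma mconv_one: "mconv a b (\<lambda>_. 1) m = mc (a + b) m"
proof (induction m)
  case 0
  then show ?case by (simp add: mconv_def)
next
  case (Suc m)
  have "real (Suc m) * mconv a b (\<lambda>_. 1) (Suc m) = real (m + a + b) * mconv a b (\<lambda>_. 1) m"
    using mconv_step[of m a b "\<lambda>_. 1"] by (simp add: mconv_def)
  also have "\<dots> = real (Suc m) * mc (a + b) (Suc m)"
    unfolding Suc using mc_Suc_right[of m "a+b"] by (simp add: algebra_simps)
  finally show ?case by simp
qed

definition mavg :: "nat \<Rightarrow> nat \<Rightarrow> (nat \<Rightarrow> real) \<Rightarrow> nat \<Rightarrow> real" where
  "mavg a b \<phi> m = mconv a b \<phi> m / mc (a + b) m"

lemma mavg_one: "a + b > 0 \<Longrightarrow> mavg a b (\<lambda>_. 1) m = 1"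
  using mc_pos[of "a+b" m] by (simp add: mavg_def mconv_one)

text \<open>Differencing in the number of particles is again an average, at the price of the factor
  \<open>a / (a + b)\<close>. Two differences starting from \<open>a = 1\<close> give the
  contraction factor \<open>2 / ((b + 1) * (b + 2))\<close>.\<close>

lemma mavg_step:
  assumes "a > 0"
  shows "mavg a b \<phi> (Suc m) - mavg a b \<phi> m = real a / real (a + b) * mavg (Suc a) b (\<lambda>j. \<phi> (Suc j) - \<phi> j) m"
proof -
  let ?c = "mc (a + b) m" let ?s = "mconv a b \<phi>"
  have c: "?c > 0" using assms by (simp add: mc_pos)
  have e: "mc (a + b) (Suc m) = real (m + a + b) * ?c / real (Suc m)"
    using mc_Suc_right[of m "a+b"] by (simp add: field_simps del: of_nat_Suc)
  have f: "mc (Suc (a + b)) m = real (m + a + b) * ?c / real (a + b)"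
    using mc_Suc_left[of "a+b" m] assms by (simp add: field_simps)
  have p: "real (m + a + b) > 0" using assms by simp
  have "mavg a b \<phi> (Suc m) = real (Suc m) * ?s (Suc m) / (real (m + a + b) * ?c)"
    unfolding mavg_def e by simp
  moreover have "mavg a b \<phi> m = real (m + a + b) * ?s m / (real (m + a + b) * ?c)"
    unfolding mavg_def using p by simp
  ultimately have "mavg a b \<phi> (Suc m) - mavg a b \<phi> m
     = (real a * mconv (Suc a) b (\<lambda>j. \<phi> (Suc j) - \<phi> j) m) / (real (m + a + b) * ?c)"
    unfolding mconv_step[symmetric] by (simp add: diff_divide_distrib)
  also have "\<dots> = real a / real (a + b) * mavg (Suc a) b (\<lambda>j. \<phi> (Suc j) - \<phi> j) m"
    unfolding mavg_def add_Suc f using assms by simp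
  finally show ?thesis .
qed

lemma mavg_bound:
  assumes "a > 0" and "\<And>j. j \<le> m \<Longrightarrow> \<bar>\<phi> j\<bar> \<le> D"
  shows "\<bar>mavg a b \<phi> m\<bar> \<le> D"
proof -
  have "\<bar>mconv a b \<phi> m\<bar> \<le> (\<Sum>j\<le>m. \<bar>\<phi> j * mc a j * mc b (m - j)\<bar>)"
    unfolding mconv_def by (rule sum_abs)
  also have "\<dots> \<le> (\<Sum>j\<le>m. D * (1 * mc a j * mc b (m - j)))"
    using assms(2) by (intro sum_mono) (auto simp: abs_mult mult_right_mono mult.assoc)
  also have "\<dots> = D * mc (a + b) m"
    unfolding mconv_one[symmetric] mconv_def sum_distrib_left ..
  finally show ?thesis unfolding mavg_def using mc_pos[of "a+b" m] assms(1) by (simp add: field_simps)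
qed

lemma mavg_id: "mavg (Suc 0) b real m = real m / real (Suc b)"
proof (induction m)
  case 0
  then show ?case by (simp add: mavg_def mconv_def)
next
  case (Suc m)
  have "mavg (Suc 0) b real (Suc m) = mavg (Suc 0) b real m + 1 / real (Suc b)"
    using mavg_step[of "Suc 0" b real m] mavg_one[of "Suc (Suc 0)" b m] by simp
  then show ?case unfolding Suc by (simp add: field_simps)
qed

lemma mavg_add: "mavg a b (\<lambda>j. \<phi> j + \<psi> j) m = mavg a b \<phi> m + mavg a b \<psi> m"
  by (simp add: mavg_def mconv_def sum.distrib add_divide_distrib algebra_simps)

lemma mavg_scale: "mavg a b (\<lambda>j. c * \<phi> j) m = c * mavg a b \<phi> m"
  by (simp add: mavg_def mconv_def sum_distrib_left mult_ac)

text \<open>A discrete Taylor estimate around the affine interpolant at 0 and 1; the crude quadratic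
  factor suffices, since only the dependence on \<open>E\<close> matters later.\<close>

lemma second_difference_bound:
  fixes g :: "nat \<Rightarrow> real"
  assumes E: "\<And>i. i + 2 \<le> m \<Longrightarrow> \<bar>g (i + 2) - 2 * g (i + 1) + g i\<bar> \<le> E" and E0: "E \<ge> 0" and im: "i \<le> m"
  shows "\<bar>g i - (g 0 + real i * (g 1 - g 0))\<bar> \<le> (real i)\<^sup>2 * E"
proof -
  have d: "\<bar>(g (Suc i) - g i) - (g 1 - g 0)\<bar> \<le> real i * E" if "Suc i \<le> m" for i
    using that
  proof (induction i)
    case (Suc i)
    then show ?case using E[of i] by (simp add: algebra_simps)
  qed simp
  show ?thesis using im
  proof (induction i)
    case (Suc i)
    have "\<bar>g (Suc i) - (g 0 + real (Suc i) * (g 1 - g 0))\<bar>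
      \<le> \<bar>g i - (g 0 + real i * (g 1 - g 0))\<bar> + \<bar>(g (Suc i) - g i) - (g 1 - g 0)\<bar>"
      by (simp add: algebra_simps)
    also have "\<dots> \<le> (real i)\<^sup>2 * E + real i * E" using Suc d[of i] by simp
    also have "\<dots> \<le> (real (Suc i))\<^sup>2 * E" using E0 by (simp add: algebra_simps power2_eq_square)
    finally show ?case .
  qed simp
qed

lemma triangle_swap:
  fixes m :: nat
  shows   "(\<Sum>k\<le>m. \<Sum>j\<le>m - k. F k j) = (\<Sum>j\<le>m. \<Sum>k\<le>m - j. (F k j :: 'c :: comm_monoid_add))"
proof -
  have "(\<Sum>k\<le>m. \<Sum>j\<le>m - k. F k j) = (\<Sum>(k,j)\<in>{(k,j). k + j \<le> m}. F k j)"
    by (subst sum.Sigma) (auto intro!: sum.cong)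
  also have "\<dots> = (\<Sum>(j,k)\<in>{(k,j). k + j \<le> m}. F k j)"
    by (rule sum.reindex_bij_witness[where i="\<lambda>(a,b). (b,a)" and j="\<lambda>(a,b). (b,a)"]) auto
  also have "\<dots> = (\<Sum>j\<le>m. \<Sum>k\<le>m - j. F k j)"
    by (subst sum.Sigma) (auto intro!: sum.cong)
  finally show ?thesis .
qed

section \<open>The two-site correlation operator and its spectral bound\<close>

text \<open>For a uniform configuration of \<open>m\<close> particles on \<open>n = b + 2\<close> sites, \<open>ip b m\<close> is the
  (unnormalised) inner product for the law of one occupation number, and \<open>cexp b m f k\<close> is the
  conditional expectation of \<open>f (\<eta> x)\<close> given \<open>\<eta> y = k\<close>.\<close>

context
  fixes b m :: nat
begin

definition ip :: "(nat \<Rightarrow> real) \<Rightarrow> (nat \<Rightarrow> real) \<Rightarrow> real" where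
  "ip f g = (\<Sum>k\<le>m. mc (Suc b) (m - k) * f k * g k)"

definition cexp :: "(nat \<Rightarrow> real) \<Rightarrow> nat \<Rightarrow> real" where
  "cexp f k = mavg 1 b f (m - k)"

lemma ip_commute: "ip f g = ip g f"
  by (simp add: ip_def mult_ac)

lemma ip_add_left: "ip (\<lambda>k. f k + g k) h = ip f h + ip g h"
  by (simp add: ip_def algebra_simps sum.distrib)

lemma ip_add_right: "ip h (\<lambda>k. f k + g k) = ip h f + ip h g"
  by (simp add: ip_def algebra_simps sum.distrib)

lemma ip_scale_left: "ip (\<lambda>k. c * f k) g = c * ip f g"
  by (simp add: ip_def sum_distrib_left mult_ac)

lemma ip_scale_right: "ip f (\<lambda>k. c * g k) = c * ip f g"
  by (simp add: ip_def sum_distrib_left mult_ac)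

lemma ip_cong: "(\<And>k. k \<le> m \<Longrightarrow> f k = f' k) \<Longrightarrow> (\<And>k. k \<le> m \<Longrightarrow> g k = g' k) \<Longrightarrow> ip f g = ip f' g'"
  by (simp add: ip_def)

lemma ip_nonneg: "ip f f \<ge> 0"
  unfolding ip_def by (intro sum_nonneg) (simp add: mult.assoc)

lemma ip_Cauchy_Schwarz: "(ip f g)\<^sup>2 \<le> ip f f * ip g g"
proof -
  let ?s = "\<lambda>k. sqrt (mc (Suc b) (m - k))"
  have "(\<Sum>k\<le>m. (?s k * f k) * (?s k * g k))\<^sup>2 \<le> (\<Sum>k\<le>m. (?s k * f k)\<^sup>2) * (\<Sum>k\<le>m. (?s k * g k)\<^sup>2)"
    by (rule Cauchy_Schwarz_ineq_sum)
  moreover have "(?s k * f k) * (?s k * g k) = mc (Suc b) (m - k) * f k * g k" for f g k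
    by (simp add: mult_ac flip: mult.assoc)
  ultimately show ?thesis unfolding ip_def power2_eq_square[of "_ * _"] by simp
qed

text \<open>The triangle of pairs \<open>(k, j)\<close> carries the joint law of two occupation
  numbers, with \<open>m - k - j\<close> particles on the other \<open>b\<close> sites. This law is
  symmetric, which is why the operator is self-adjoint.\<close>

lemma ip_cexp: "ip f (cexp g) = (\<Sum>k\<le>m. \<Sum>j\<le>m - k. f k * g j * mc b (m - k - j))"
proof -
  have "mc (Suc b) (m - k) * f k * cexp g k = (\<Sum>j\<le>m - k. f k * g j * mc b (m - k - j))" for k
  proof -
    have "mc (Suc b) (m - k) * f k * cexp g k = f k * mconv 1 b g (m - k)"
      using mc_pos[of "Suc b" "m-k"] by (simp add: cexp_def mavg_def)
    then show ?thesis by (simp add: mconv_def sum_distrib_left mult_ac)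
  qed
  then show ?thesis by (simp add: ip_def)
qed

lemma cexp_selfadjoint: "ip f (cexp g) = ip (cexp f) g"
  unfolding ip_commute[of "cexp f"] ip_cexp
  by (subst triangle_swap) (simp add: mult_ac add.commute)

text \<open>Given \<open>k\<close> particles at one site, the other \<open>m - k\<close> are shared
  equally in mean by \<open>b + 1\<close> sites, so affine functions form an invariant
  subspace.\<close>

lemma cexp_linear:
  assumes "k \<le> m"
  shows "cexp (\<lambda>j. c + d * real j) k = c + d * (real (m - k) / real (Suc b))"
  using mavg_add[of 1 b "\<lambda>j. c * 1" "\<lambda>j. d * real j" "m-k"] mavg_scale[of 1 b c "\<lambda>_. 1" "m-k"]
    mavg_scale[of 1 b d real "m-k"] mavg_one[of 1 b "m-k"] mavg_id[of b "m-k"]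
  by (simp add: cexp_def)

text \<open>Two applications of \<open>mavg_step\<close>; the reversal from \<open>k\<close> to
  \<open>m - k\<close> does not change the sign of a second difference.\<close>

lemma cexp_second_difference:
  assumes "k + 2 \<le> m"
  shows "cexp f (k + 2) - 2 * cexp f (k + 1) + cexp f k
     = 2 / (real (b + 1) * real (b + 2)) * mavg 3 b (\<lambda>j. f (j + 2) - 2 * f (j + 1) + f j) (m - k - 2)"
proof -
  define l where "l = m - k - 2"
  have eqs: "m - (k + 2) = l" "m - (k + 1) = Suc l" "m - k = Suc (Suc l)" "m - k - 2 = l"
    using assms by (auto simp: l_def)
  let ?d = "\<lambda>j. f (Suc j) - f j"
  have "mavg 1 b f (Suc (Suc l)) - mavg 1 b f (Suc l) = 1 / real (b + 1) * mavg 2 b ?d (Suc l)"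
    using mavg_step[of 1 b f "Suc l"] by (simp add: numeral_2_eq_2)
  moreover have "mavg 1 b f (Suc l) - mavg 1 b f l = 1 / real (b + 1) * mavg 2 b ?d l"
    using mavg_step[of 1 b f l] by (simp add: numeral_2_eq_2)
  ultimately have "cexp f (k + 2) - 2 * cexp f (k + 1) + cexp f k
      = 1 / real (b + 1) * (mavg 2 b ?d (Suc l) - mavg 2 b ?d l)"
    unfolding cexp_def eqs by (simp add: right_diff_distrib)
  also have "mavg 2 b ?d (Suc l) - mavg 2 b ?d l = 2 / real (b + 2) * mavg 3 b (\<lambda>j. ?d (Suc j) - ?d j) l"
    using mavg_step[of 2 b ?d l] by (simp add: numeral_3_eq_3 numeral_2_eq_2)
  finally show ?thesis unfolding eqs by (simp add: algebra_simps)
qed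

text \<open>The operator contracts second differences by \<open>2 / (n (n - 1))\<close>, and these control a function
  orthogonal to all affine ones; for a self-adjoint operator the decay rate of the iterates bounds
  the norm.\<close>

lemma cexp_contraction:
  assumes one: "ip f (\<lambda>_. 1) = 0" and id: "ip f real = 0"
  shows "ip (cexp f) (cexp f) \<le> (2 / (real (b + 1) * real (b + 2)))\<^sup>2 * ip f f"
proof -
  define \<mu> where "\<mu> = 2 / (real (b + 1) * real (b + 2))"
  have \<mu>: "\<mu> > 0" by (simp add: \<mu>_def)
  define g where "g k = (cexp ^^ k) f" for k
  have g0: "g 0 = f" and gS: "g (Suc k) = cexp (g k)" for k by (simp_all add: g_def)
  have orth: "ip (g k) (\<lambda>_. 1) = 0 \<and> ip (g k) real = 0" for k
  proof (induction k)
    case 0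
    then show ?case using one id by (simp add: g0)
  next
    case (Suc k)
    have "ip (g (Suc k)) (\<lambda>_. 1) = ip (g k) (cexp (\<lambda>_. 1))" by (simp add: gS cexp_selfadjoint)
    also have "\<dots> = ip (g k) (\<lambda>_. 1)" using cexp_linear[of _ 1 0] by (intro ip_cong) auto
    finally have 1: "ip (g (Suc k)) (\<lambda>_. 1) = 0" using Suc by simp
    have "ip (g (Suc k)) real = ip (g k) (cexp real)" by (simp add: gS cexp_selfadjoint)
    also have "\<dots> = ip (g k) (\<lambda>j. real m / real (Suc b) * 1 + (- 1 / real (Suc b)) * real j)"
      using cexp_linear[of _ 0 1] by (intro ip_cong) (auto simp: diff_divide_distrib)
    also have "\<dots> = 0" unfolding ip_add_right ip_scale_right using Suc by simp
    finally show ?case using 1 by simp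
  qed
  define D where "D = (\<Sum>j\<le>m. \<bar>f (j + 2) - 2 * f (j + 1) + f j\<bar>)"
  have D0: "D \<ge> 0" by (simp add: D_def)
  have diff2: "\<bar>g k (j + 2) - 2 * g k (j + 1) + g k j\<bar> \<le> \<mu> ^ k * D" if "j + 2 \<le> m" for k j
    using that
  proof (induction k arbitrary: j)
    case 0
    have "\<bar>f (j + 2) - 2 * f (j + 1) + f j\<bar> \<le> D"
      unfolding D_def by (rule member_le_sum) (use 0 in auto)
    then show ?case by (simp add: g0)
  next
    case (Suc k)
    have "\<bar>mavg 3 b (\<lambda>j. g k (j + 2) - 2 * g k (j + 1) + g k j) (m - j - 2)\<bar> \<le> \<mu> ^ k * D"
      by (rule mavg_bound) (use Suc in auto)
    then have "\<mu> * \<bar>mavg 3 b (\<lambda>j. g k (j + 2) - 2 * g k (j + 1) + g k j) (m - j - 2)\<bar> \<le> \<mu> * (\<mu> ^ k * D)"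
      using \<mu> by (intro mult_left_mono) auto
    then show ?case unfolding gS cexp_second_difference[OF Suc.prems] \<mu>_def[symmetric] abs_mult
      using \<mu> by simp
  qed
  define W where "W = ip (\<lambda>_. 1) (\<lambda>_. 1)"
  have bound: "ip (g k) (g k) \<le> (W * (real m)^4 * D\<^sup>2) * (\<mu>\<^sup>2) ^ k" for k
  proof -
    let ?E = "\<mu> ^ k * D"
    \<comment> \<open>\<open>?r\<close> is \<open>g k\<close> minus its affine interpolant at 0 and
      1. Since \<open>g k\<close> is orthogonal to affine functions, subtracting one can only
      increase the norm, and \<open>?r\<close> is controlled by second differences.\<close>
    define c where "c = - (g k 0)" define d where "d = - (g k 1 - g k 0)"
    let ?r = "\<lambda>i. g k i + (c * 1 + d * real i)"
    have "ip ?r ?r = ip (g k) (g k) + ip (\<lambda>i. c * 1 + d * real i) (\<lambda>i. c * 1 + d * real i)"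
      using orth[of k]
      by (simp only: ip_add_left ip_add_right ip_scale_left ip_scale_right ip_commute[of "\<lambda>_. 1" "g k"] ip_commute[of real "g k"])
    then have "ip (g k) (g k) \<le> ip ?r ?r" using ip_nonneg[of "\<lambda>i. c * 1 + d * real i"] by simp
    also have "\<dots> \<le> (\<Sum>i\<le>m. mc (Suc b) (m - i) * ((real m)\<^sup>2 * ?E)\<^sup>2)"
      unfolding ip_def
    proof (rule sum_mono)
      fix i assume i: "i \<in> {..m}"
      have "\<bar>?r i\<bar> \<le> (real i)\<^sup>2 * ?E"
        using second_difference_bound[of m "g k" ?E i] diff2[of _ k] i D0 \<mu> by (simp add: c_def d_def algebra_simps)
      also have "\<dots> \<le> (real m)\<^sup>2 * ?E" using i D0 \<mu> by (intro mult_right_mono power_mono) auto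
      finally have "(?r i)\<^sup>2 \<le> ((real m)\<^sup>2 * ?E)\<^sup>2" by (metis abs_ge_zero power2_abs power_mono)
      then show "mc (Suc b) (m - i) * ?r i * ?r i \<le> mc (Suc b) (m - i) * ((real m)\<^sup>2 * ?E)\<^sup>2"
        unfolding mult.assoc power2_eq_square[of "?r i"] by (intro mult_left_mono) auto
    qed
    also have "\<dots> = (W * (real m)^4 * D\<^sup>2) * (\<mu>\<^sup>2) ^ k"
      unfolding W_def ip_def by (simp add: sum_distrib_left power_mult_distrib power_even_eq mult_ac flip: power_mult)
    finally show ?thesis .
  qed
  have "ip (g 1) (g 1) \<le> \<mu>\<^sup>2 * ip (g 0) (g 0)"
  \<comment> \<open>Self-adjointness moves one application of the operator across the inner product,
    and Cauchy-Schwarz then gives log-convexity of the squared norms.\<close>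
  proof (rule log_convex_growth[where a="\<lambda>k. ip (g k) (g k)", OF ip_nonneg _ bound])
    fix k
    have "ip (g (Suc k)) (g (Suc k)) = ip (g k) (g (Suc (Suc k)))"
      unfolding gS by (simp add: cexp_selfadjoint)
    then show "(ip (g (Suc k)) (g (Suc k)))\<^sup>2 \<le> ip (g k) (g k) * ip (g (Suc (Suc k))) (g (Suc (Suc k)))"
      using ip_Cauchy_Schwarz by metis
  qed (use \<mu> in simp)
  then show ?thesis using gS[of 0] by (simp add: g0 \<mu>_def)
qed

text \<open>Split \<open>f\<close> into its projection on the centred identity \<open>l\<close> and
  a remainder \<open>h\<close> orthogonal to all affine functions. The eigenvalue of
  \<open>l\<close> is \<open>- 1 / (b + 1)\<close>, whose sign is favourable for an upper bound, and
  \<open>cexp_contraction\<close> handles \<open>h\<close>.\<close>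

lemma cexp_upper:
  assumes one: "ip f (\<lambda>_. 1) = 0"
  shows "ip f (cexp f) \<le> 2 / (real (b + 1) * real (b + 2)) * ip f f"
proof -
  define \<mu> where "\<mu> = 2 / (real (b + 1) * real (b + 2))"
  have \<mu>: "\<mu> > 0" by (simp add: \<mu>_def)
  define l where "l j = - (real m / real (b + 2)) * 1 + 1 * real j" for j :: nat
  have Pl: "cexp l k = - 1 / real (b + 1) * l k" if "k \<le> m" for k
  proof -
    have "cexp l k = - (real m / real (b + 2)) + (real (m - k) / real (Suc b))"
      using cexp_linear[OF that, of "- (real m / real (b + 2))" 1] by (simp add: l_def[abs_def])
    also have "\<dots> = - 1 / real (b + 1) * l k" using that by (simp add: l_def divide_simps) (simp add: algebra_simps)
    finally show ?thesis .
  qed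
  have Pl': "ip h (cexp l) = - 1 / real (b + 1) * ip h l" for h
    unfolding ip_scale_right[symmetric] using Pl by (intro ip_cong) auto
  \<comment> \<open>Constants and \<open>l\<close> are eigenvectors of a self-adjoint operator for
    the distinct eigenvalues 1 and \<open>- 1 / (b + 1)\<close>.\<close>
  have l1: "ip l (\<lambda>_. 1) = 0"
  proof -
    have "ip l (\<lambda>_. 1) = ip l (cexp (\<lambda>_. 1))" using cexp_linear[of _ 1 0] by (intro ip_cong) auto
    also have "\<dots> = - 1 / real (b + 1) * ip l (\<lambda>_. 1)"
      unfolding cexp_selfadjoint by (subst (1 2) ip_commute) (rule Pl')
    finally have "ip l (\<lambda>_. 1) * (1 + 1 / real (b + 1)) = 0" by (simp add: algebra_simps)
    moreover have "1 + 1 / real (b + 1) > 0" by (simp add: add_pos_pos)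
    ultimately show ?thesis by simp
  qed
  define \<alpha> where "\<alpha> = ip f l / ip l l"
  define h where "h k = f k + (- \<alpha>) * l k" for k
  have f: "f = (\<lambda>k. \<alpha> * l k + 1 * h k)" by (simp add: h_def fun_eq_iff)
  \<comment> \<open>If \<open>ip l l = 0\<close>, which happens for \<open>m = 0\<close>, division
    by zero sets \<open>\<alpha>\<close> to 0, and Cauchy-Schwarz gives \<open>ip f l = 0\<close> as
    well.\<close>
  have fl: "ip f l = \<alpha> * ip l l"
    using ip_Cauchy_Schwarz[of f l] by (cases "ip l l = 0") (auto simp: \<alpha>_def)
  have hl: "ip h l = 0" using fl unfolding h_def ip_add_left ip_scale_left by simp
  have h1: "ip h (\<lambda>_. 1) = 0" using one l1 unfolding h_def ip_add_left ip_scale_left by simp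
  have hid: "ip h real = 0" using hl h1 unfolding l_def ip_add_right ip_scale_right by simp
  have "(ip h (cexp h))\<^sup>2 \<le> ip h h * ip (cexp h) (cexp h)" by (rule ip_Cauchy_Schwarz)
  also have "\<dots> \<le> ip h h * (\<mu>\<^sup>2 * ip h h)"
    using cexp_contraction[OF h1 hid] ip_nonneg[of h] unfolding \<mu>_def by (intro mult_left_mono) auto
  also have "\<dots> = (\<mu> * ip h h)\<^sup>2" by (simp add: power2_eq_square)
  finally have hh: "ip h (cexp h) \<le> \<mu> * ip h h"
    using power2_le_imp_le \<mu> ip_nonneg[of h] by (metis mult_nonneg_nonneg less_imp_le)
  have cl: "cexp f k = \<alpha> * cexp l k + 1 * cexp h k" for k
    unfolding cexp_def by (subst f) (simp only: mavg_add mavg_scale)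
  have lh: "ip l h = 0" "ip l (cexp h) = 0" using hl Pl'[of h] by (simp_all add: ip_commute[of l] cexp_selfadjoint[symmetric])
  have "ip f (cexp f) = \<alpha>\<^sup>2 * ip l (cexp l) + ip h (cexp h)"
    unfolding cl[abs_def] by (subst f) (simp only: ip_add_left ip_add_right ip_scale_left ip_scale_right lh hl Pl', simp add: power2_eq_square)
  also have "\<dots> \<le> 0 + \<mu> * ip h h"
  proof (rule add_mono[OF _ hh])
    show "\<alpha>\<^sup>2 * ip l (cexp l) \<le> 0" unfolding Pl' using ip_nonneg[of l] by (simp add: mult_nonneg_nonneg)
  qed
  also have "\<dots> \<le> \<mu> * ip f f"
  proof -
    have "ip f f = \<alpha>\<^sup>2 * ip l l + ip h h"
      by (subst (1 2) f) (simp only: ip_add_left ip_add_right ip_scale_left ip_scale_right lh hl, simp add: power2_eq_square)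
    then show ?thesis using ip_nonneg[of l] \<mu> by simp
  qed
  finally show ?thesis by (simp add: \<mu>_def)
qed

end

section \<open>Configurations and conditioning on one site\<close>

text \<open>Left unnormalised, so that the contributions of fibres of different sizes add up without
  weights.\<close>

definition var_sum :: "'a set \<Rightarrow> ('a \<Rightarrow> real) \<Rightarrow> real" where
  "var_sum A f = (\<Sum>a\<in>A. (f a - sum f A / real (card A))\<^sup>2)"

lemma var_sum_nonneg: "var_sum A f \<ge> 0"
  by (simp add: var_sum_def sum_nonneg)

lemma sum_squares_about:
  assumes "finite A"
  shows "(\<Sum>a\<in>A. (f a - c)\<^sup>2) = var_sum A f + real (card A) * (sum f A / real (card A) - c)\<^sup>2"
proof (cases "A = {}")
  case False
  define N M where "N = real (card A)" and "M = sum f A / N"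
  have N: "N > 0" using False assms by (simp add: N_def card_gt_0_iff)
  have "(\<Sum>a\<in>A. (f a - c)\<^sup>2) = (\<Sum>a\<in>A. (f a - M)\<^sup>2 + 2 * (M - c) * (f a - M) + (M - c)\<^sup>2)"
    by (intro sum.cong) (simp_all add: power2_eq_square algebra_simps)
  also have "\<dots> = (\<Sum>a\<in>A. (f a - M)\<^sup>2) + 2 * (M - c) * (sum f A - N * M) + N * (M - c)\<^sup>2"
    by (simp add: sum.distrib sum_subtractf N_def flip: sum_distrib_left)
  also have "sum f A - N * M = 0" using N by (simp add: M_def)
  finally show ?thesis by (simp add: var_sum_def M_def N_def)
qed (simp add: var_sum_def)

lemma var_sum_le: "finite A \<Longrightarrow> var_sum A f \<le> (\<Sum>a\<in>A. (f a - c)\<^sup>2)"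
  by (simp add: sum_squares_about)

lemma var_sum_eq: "finite A \<Longrightarrow> var_sum A f = (\<Sum>a\<in>A. (f a)\<^sup>2) - (sum f A)\<^sup>2 / real (card A)"
  using sum_squares_about[of A f 0] by (simp add: power2_eq_square)

lemma var_sum_shift: "finite A \<Longrightarrow> var_sum A (\<lambda>a. f a - c) = var_sum A f"
  unfolding var_sum_def
  by (cases "A = {}") (auto simp: sum_subtractf diff_divide_distrib intro!: sum.cong)

text \<open>Because configurations vanish off \<open>S\<close>, those on disjoint sets combine by
  pointwise addition.\<close>

definition conf :: "'a set \<Rightarrow> nat \<Rightarrow> ('a \<Rightarrow> nat) set" where
  "conf S m = {\<eta>. (\<forall>x. x \<notin> S \<longrightarrow> \<eta> x = 0) \<and> sum \<eta> S = m}"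

definition single :: "'a \<Rightarrow> nat \<Rightarrow> 'a \<Rightarrow> nat" where
  "single x k = (\<lambda>i. if i = x then k else 0)"

lemma single_apply [simp]: "single x k i = (if i = x then k else 0)"
  by (simp add: single_def)

lemma finite_conf [simp]:
  assumes "finite S" shows "finite (conf S m)"
proof (rule finite_subset)
  show "conf S m \<subseteq> {f. \<forall>x. (x \<in> S \<longrightarrow> f x \<in> {..m}) \<and> (x \<notin> S \<longrightarrow> f x = 0)}"
    using assms by (auto simp: conf_def intro: member_le_sum)
qed (use assms in \<open>intro finite_set_of_finite_funs; simp\<close>)

lemma conf_empty: "conf {} m = (if m = 0 then {0} else {})"
  by (auto simp: conf_def fun_eq_iff)

lemma conf_singleton: "conf {x} k = {single x k}"
  by (auto simp: conf_def fun_eq_iff)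

lemma sum_conf_Un:
  assumes "finite A" "finite B" "A \<inter> B = {}"
  shows "(\<Sum>\<eta>\<in>conf (A \<union> B) m. g \<eta> :: 'c :: comm_monoid_add)
    = (\<Sum>k\<le>m. \<Sum>\<alpha>\<in>conf A (m - k). \<Sum>\<beta>\<in>conf B k. g (\<alpha> + \<beta>))"
proof -
  have "(\<Sum>k\<le>m. \<Sum>\<alpha>\<in>conf A (m - k). \<Sum>\<beta>\<in>conf B k. g (\<alpha> + \<beta>))
    = (\<Sum>(k,\<alpha>,\<beta>)\<in>(SIGMA k:{..m}. conf A (m - k) \<times> conf B k). g (\<alpha> + \<beta>))"
    using assms by (simp add: sum.Sigma sum.cartesian_product)
  also have "\<dots> = (\<Sum>\<eta>\<in>conf (A \<union> B) m. g \<eta>)"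
  proof (rule sum.reindex_bij_witness[where
      i="\<lambda>\<eta>. (sum \<eta> B, (\<lambda>x. if x \<in> A then \<eta> x else 0), (\<lambda>x. if x \<in> B then \<eta> x else 0))"
      and j="\<lambda>(k,\<alpha>,\<beta>). \<alpha> + \<beta>"], goal_cases)
    case (1 a)
    then obtain k \<alpha> \<beta> where a: "a = (k,\<alpha>,\<beta>)" "\<alpha> \<in> conf A (m-k)" "\<beta> \<in> conf B k" by auto
    have "\<alpha> x = 0" if "x \<in> B" for x using a assms that by (auto simp: conf_def)
    moreover have "\<beta> x = 0" if "x \<in> A" for x using a assms that by (auto simp: conf_def)
    ultimately show ?case using a by (auto simp: conf_def fun_eq_iff)
  next
    case (2 a)
    then obtain k \<alpha> \<beta> where a: "a = (k,\<alpha>,\<beta>)" "k \<le> m" "\<alpha> \<in> conf A (m-k)" "\<beta> \<in> conf B k" by auto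
    have "\<alpha> x = 0" if "x \<in> B" for x using a assms that by (auto simp: conf_def)
    moreover have "\<beta> x = 0" if "x \<in> A" for x using a assms that by (auto simp: conf_def)
    ultimately show ?case using a assms by (auto simp: conf_def sum.union_disjoint)
  next
    case (3 \<eta>)
    then show ?case using assms(3) by (auto simp: conf_def fun_eq_iff disjoint_iff)
  next
    case (4 \<eta>)
    then have "sum \<eta> A + sum \<eta> B = m" using assms by (simp add: conf_def sum.union_disjoint)
    then show ?case by (auto simp: conf_def)
  qed auto
  finally show ?thesis by simp
qed

lemma sum_conf_remove:
  assumes "finite S" "x \<in> S"
  shows "(\<Sum>\<eta>\<in>conf S m. g \<eta> :: 'c :: comm_monoid_add)
    = (\<Sum>k\<le>m. \<Sum>\<zeta>\<in>conf (S - {x}) (m - k). g (\<zeta> + single x k))"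
  using sum_conf_Un[of "S - {x}" "{x}" g m] assms by (simp add: conf_singleton insert_absorb)

lemma card_conf:
  assumes "finite S" shows "real (card (conf S m)) = mc (card S) m"
  using assms
proof (induction S arbitrary: m rule: finite_induct)
  case empty
  then show ?case by (cases m) (auto simp: conf_empty mc_def)
next
  case (insert x S)
  have "real (card (conf (insert x S) m)) = (\<Sum>\<eta>\<in>conf (insert x S) m. 1)" by simp
  also have "\<dots> = (\<Sum>k\<le>m. \<Sum>\<zeta>\<in>conf S (m - k). 1)"
    using insert by (subst sum_conf_remove[of _ x]) auto
  also have "\<dots> = mconv 1 (card S) (\<lambda>_. 1) m"
    using insert by (simp add: mconv_def)
  also have "\<dots> = mc (card (insert x S)) m" using insert by (simp add: mconv_one)
  finally show ?case .
qed

lemma ip_sum_left: "ip b m (\<lambda>k. \<Sum>x\<in>S. \<phi> x k) g = (\<Sum>x\<in>S. ip b m (\<phi> x) g)"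
  unfolding ip_def by (simp add: sum_distrib_left sum_distrib_right) (rule sum.swap)

lemma ip_sum_right: "ip b m g (\<lambda>k. \<Sum>x\<in>S. \<phi> x k) = (\<Sum>x\<in>S. ip b m g (\<phi> x))"
  unfolding ip_def by (simp add: sum_distrib_left sum_distrib_right) (rule sum.swap)

lemma cexp_sum: "cexp b m (\<lambda>k. \<Sum>x\<in>S. \<phi> x k) = (\<lambda>k. \<Sum>x\<in>S. cexp b m (\<phi> x) k)"
  by (rule ext)
    (simp add: cexp_def mavg_def mconv_def sum_distrib_left sum_distrib_right sum_divide_distrib, rule sum.swap)

lemma cexp_scale: "cexp b m (\<lambda>j. c * f j) = (\<lambda>j. c * cexp b m f j)"
  by (rule ext) (simp add: cexp_def mavg_scale)

lemma cexp_add: "cexp b m (\<lambda>j. f j + g j) = (\<lambda>j. cexp b m f j + cexp b m g j)"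
  by (rule ext) (simp add: cexp_def mavg_add)

section \<open>Spectral bounds for sums of one-site functions\<close>

context
  fixes S :: "'a set" and b m :: nat
  assumes fin: "finite S" and card: "card S = b + 2"
begin

text \<open>The second argument of \<open>ip\<close> is the conditional expectation of
  \<open>f\<close> given that site \<open>x\<close> carries \<open>k\<close> particles.\<close>

lemma sum_conf_site_fun:
  assumes x: "x \<in> S"
  shows "(\<Sum>\<eta>\<in>conf S m. h (\<eta> x) * f \<eta>)
    = ip b m h (\<lambda>k. (\<Sum>\<zeta>\<in>conf (S - {x}) (m - k). f (\<zeta> + single x k)) / mc (Suc b) (m - k))"
proof -
  have z: "\<zeta> x = 0" if "\<zeta> \<in> conf (S - {x}) l" for \<zeta> l using that by (auto simp: conf_def)
  have "(\<Sum>\<eta>\<in>conf S m. h (\<eta> x) * f \<eta>) = (\<Sum>k\<le>m. \<Sum>\<zeta>\<in>conf (S - {x}) (m - k). h k * f (\<zeta> + single x k))"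
    using sum_conf_remove[OF fin x, of "\<lambda>\<eta>. h (\<eta> x) * f \<eta>" m] by (simp add: z cong: sum.cong)
  also have "\<dots> = ip b m h (\<lambda>k. (\<Sum>\<zeta>\<in>conf (S - {x}) (m - k). f (\<zeta> + single x k)) / mc (Suc b) (m - k))"
    unfolding ip_def
  proof (rule sum.cong[OF refl])
    fix k
    have "mc (Suc b) (m - k) > 0" by (simp add: mc_pos)
    then show "(\<Sum>\<zeta>\<in>conf (S - {x}) (m - k). h k * f (\<zeta> + single x k)) =
       mc (Suc b) (m - k) * h k * ((\<Sum>\<zeta>\<in>conf (S - {x}) (m - k). f (\<zeta> + single x k)) / mc (Suc b) (m - k))"
      by (simp flip: sum_distrib_left)
  qed
  finally show ?thesis .
qed

lemma card_conf_remove: "x \<in> S \<Longrightarrow> real (card (conf (S - {x}) l)) = mc (Suc b) l"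
  using card_conf[of "S - {x}" l] fin card by simp

lemma sum_conf_site_fun_same:
  assumes x: "x \<in> S"
  shows "(\<Sum>\<eta>\<in>conf S m. h (\<eta> x) * g (\<eta> x)) = ip b m h g"
proof -
  have z: "\<zeta> x = 0" if "\<zeta> \<in> conf (S - {x}) l" for \<zeta> l using that by (auto simp: conf_def)
  show ?thesis unfolding sum_conf_site_fun[OF x, of h "\<lambda>\<eta>. g (\<eta> x)"]
  proof (rule ip_cong)
    fix k
    have "(\<Sum>\<zeta>\<in>conf (S - {x}) (m - k). g ((\<zeta> + single x k) x)) = mc (Suc b) (m - k) * g k"
      using card_conf_remove[OF x, of "m-k"] by (simp add: z cong: sum.cong)
    then show "(\<Sum>\<zeta>\<in>conf (S - {x}) (m - k). g ((\<zeta> + single x k) x)) / mc (Suc b) (m - k) = g k"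
      using mc_pos[of "Suc b" "m-k"] by simp
  qed auto
qed

lemma sum_conf_site_fun_other:
  assumes x: "x \<in> S" and y: "y \<in> S" and xy: "x \<noteq> y"
  shows "(\<Sum>\<eta>\<in>conf S m. h (\<eta> x) * g (\<eta> y)) = ip b m h (cexp b m g)"
  unfolding sum_conf_site_fun[OF x, of h "\<lambda>\<eta>. g (\<eta> y)"]
proof (rule ip_cong)
  fix k
  have z: "\<zeta> y = 0" if "\<zeta> \<in> conf (S - {x} - {y}) l" for \<zeta> l using that by (auto simp: conf_def)
  have c: "real (card (conf (S - {x} - {y}) l)) = mc b l" for l
    using card_conf[of "S - {x} - {y}" l] fin card x y xy by simp
  have "(\<Sum>\<zeta>\<in>conf (S - {x}) (m - k). g ((\<zeta> + single x k) y)) = (\<Sum>\<zeta>\<in>conf (S - {x}) (m - k). g (\<zeta> y))"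
    using xy by simp
  also have "\<dots> = mconv 1 b g (m - k)"
    using fin y xy sum_conf_remove[of "S - {x}" y "\<lambda>\<zeta>. g (\<zeta> y)" "m - k"]
    by (simp add: z c mconv_def mult.commute cong: sum.cong)
  finally show "(\<Sum>\<zeta>\<in>conf (S - {x}) (m - k). g ((\<zeta> + single x k) y)) / mc (Suc b) (m - k) = cexp b m g k"
    by (simp add: cexp_def mavg_def)
qed auto

lemma sum_square_site_funs:
  "(\<Sum>\<eta>\<in>conf S m. (\<Sum>x\<in>S. \<phi> x (\<eta> x))\<^sup>2)
    = (\<Sum>x\<in>S. ip b m (\<phi> x) (\<phi> x)) + (\<Sum>x\<in>S. \<Sum>y\<in>S - {x}. ip b m (\<phi> x) (cexp b m (\<phi> y)))"
proof -
  have "(\<Sum>\<eta>\<in>conf S m. (\<Sum>x\<in>S. \<phi> x (\<eta> x))\<^sup>2) = (\<Sum>\<eta>\<in>conf S m. \<Sum>x\<in>S. \<Sum>y\<in>S. \<phi> x (\<eta> x) * \<phi> y (\<eta> y))"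
    by (simp add: power2_eq_square sum_product)
  also have "\<dots> = (\<Sum>x\<in>S. \<Sum>y\<in>S. \<Sum>\<eta>\<in>conf S m. \<phi> x (\<eta> x) * \<phi> y (\<eta> y))"
    by (subst sum.swap, rule sum.cong[OF refl], rule sum.swap)
  also have "\<dots> = (\<Sum>x\<in>S. ip b m (\<phi> x) (\<phi> x) + (\<Sum>y\<in>S - {x}. ip b m (\<phi> x) (cexp b m (\<phi> y))))"
  proof (rule sum.cong[OF refl])
    fix x assume x: "x \<in> S"
    show "(\<Sum>y\<in>S. \<Sum>\<eta>\<in>conf S m. \<phi> x (\<eta> x) * \<phi> y (\<eta> y))
      = ip b m (\<phi> x) (\<phi> x) + (\<Sum>y\<in>S - {x}. ip b m (\<phi> x) (cexp b m (\<phi> y)))"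
      unfolding sum.remove[OF fin x]
      using x by (intro arg_cong2[where f="(+)"] sum.cong) (auto simp: sum_conf_site_fun_same sum_conf_site_fun_other)
  qed
  finally show ?thesis by (simp add: sum.distrib)
qed

text \<open>Apply the same \<open>g\<close> at all \<open>n = b + 2\<close> sites: the square of the
  sum is nonnegative and expands into \<open>n\<close> diagonal and \<open>n * (n - 1)\<close> equal
  off-diagonal terms.\<close>

lemma cexp_lower: "ip b m g (cexp b m g) \<ge> - (1 / real (b + 1)) * ip b m g g"
proof -
  have "0 \<le> (\<Sum>\<eta>\<in>conf S m. (\<Sum>x\<in>S. g (\<eta> x))\<^sup>2)" by (simp add: sum_nonneg)
  also have "\<dots> = real (b + 2) * (ip b m g g + real (b + 1) * ip b m g (cexp b m g))"
    using sum_square_site_funs[of "\<lambda>_. g"] fin card by (simp add: algebra_simps)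
  finally have "0 \<le> ip b m g g + real (b + 1) * ip b m g (cexp b m g)"
    by (simp add: zero_le_mult_iff)
  then show ?thesis by (simp add: field_simps)
qed

text \<open>Write \<open>\<phi> x = \<Phi> / n + \<psi> x\<close>, where the \<open>\<psi> x\<close>
  sum to zero. The off-diagonal sum becomes \<open>(1 - 1 / n) * A\<close> minus the diagonal terms
  of the \<open>\<psi> x\<close>. The first is bounded by \<open>cexp_upper\<close>, the second by
  \<open>cexp_lower\<close>; as \<open>1 / (n - 1) \<le> 2 / n\<close>, both have the same constant
  \<open>2 / n\<close>.\<close>

lemma cexp_off_diagonal:
  assumes one: "\<And>x. x \<in> S \<Longrightarrow> ip b m (\<phi> x) (\<lambda>_. 1) = 0"
  shows "(\<Sum>x\<in>S. \<Sum>y\<in>S - {x}. ip b m (\<phi> x) (cexp b m (\<phi> y)))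
     \<le> 2 / real (b + 2) * (\<Sum>x\<in>S. ip b m (\<phi> x) (\<phi> x))"
proof -
  define n where "n = real (b + 2)"
  have n: "n \<ge> 2" by (simp add: n_def)
  define \<Phi> where "\<Phi> = (\<lambda>k. \<Sum>x\<in>S. \<phi> x k)"
  define H where "H = (\<Sum>x\<in>S. ip b m (\<phi> x) (\<phi> x))"
  define T where "T = (\<Sum>x\<in>S. ip b m (\<phi> x) (cexp b m (\<phi> x)))"
  define A where "A = ip b m \<Phi> (cexp b m \<Phi>)"
  define Q where "Q = ip b m \<Phi> \<Phi>"
  have Aeq: "A = (\<Sum>x\<in>S. \<Sum>y\<in>S. ip b m (\<phi> x) (cexp b m (\<phi> y)))"
    unfolding A_def \<Phi>_def cexp_sum ip_sum_left unfolding ip_sum_right by (rule refl)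
  have lhs: "(\<Sum>x\<in>S. \<Sum>y\<in>S - {x}. ip b m (\<phi> x) (cexp b m (\<phi> y))) = A - T"
    unfolding Aeq T_def sum_subtractf[symmetric]
    by (rule sum.cong[OF refl]) (simp add: sum_diff1 fin)
  have "ip b m \<Phi> (\<lambda>_. 1) = 0" using one by (simp add: \<Phi>_def ip_sum_left)
  from cexp_upper[OF this] have up: "A \<le> 2 / ((n - 1) * n) * Q"
    by (simp add: A_def Q_def n_def algebra_simps)
  define \<psi> where "\<psi> x = (\<lambda>k. \<phi> x k + (- 1 / n) * \<Phi> k)" for x
  have \<Phi>_left: "(\<Sum>x\<in>S. ip b m (\<phi> x) g) = ip b m \<Phi> g" for g
    by (simp add: \<Phi>_def ip_sum_left)
  have s0: "(\<Sum>x\<in>S. ip b m \<Phi> (\<phi> x)) = (\<Sum>x\<in>S. ip b m (\<phi> x) \<Phi>)"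
    by (intro sum.cong refl ip_commute)
  have s1: "(\<Sum>x\<in>S. ip b m (\<phi> x) \<Phi>) = Q" "(\<Sum>x\<in>S. ip b m \<Phi> (\<phi> x)) = Q"
    by (simp_all only: s0 \<Phi>_left Q_def)
  have s2: "(\<Sum>x\<in>S. ip b m (\<phi> x) (cexp b m \<Phi>)) = A"
    by (simp add: A_def \<Phi>_left)
  have s3: "(\<Sum>x\<in>S. ip b m \<Phi> (cexp b m (\<phi> x))) = A"
    unfolding s2[symmetric] by (intro sum.cong refl) (metis cexp_selfadjoint ip_commute)
  have nS: "real (card S) = n" using card by (simp add: n_def)
  have q1: "(\<Sum>x\<in>S. ip b m (\<psi> x) (\<psi> x)) = H - Q / n"
  proof -
    have "(\<Sum>x\<in>S. ip b m (\<psi> x) (\<psi> x)) = H + (- 1 / n) * Q + (- 1 / n) * (Q + n * ((- 1 / n) * Q))"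
      unfolding \<psi>_def ip_add_left ip_add_right ip_scale_left ip_scale_right sum.distrib sum_distrib_left[symmetric] s1
      by (simp add: H_def Q_def nS distrib_left flip: sum_distrib_left)
    then show ?thesis using n by (simp add: field_simps)
  qed
  have q2: "(\<Sum>x\<in>S. ip b m (\<psi> x) (cexp b m (\<psi> x))) = T - A / n"
  proof -
    have "(\<Sum>x\<in>S. ip b m (\<psi> x) (cexp b m (\<psi> x))) = T + (- 1 / n) * A + (- 1 / n) * (A + n * ((- 1 / n) * A))"
      unfolding \<psi>_def cexp_add cexp_scale ip_add_left ip_add_right ip_scale_left ip_scale_right sum.distrib sum_distrib_left[symmetric] s2 s3
      by (simp add: T_def A_def nS distrib_left flip: sum_distrib_left)
    then show ?thesis using n by (simp add: field_simps)
  qed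
  have "T - A / n \<ge> (\<Sum>x\<in>S. - (1 / (n - 1)) * ip b m (\<psi> x) (\<psi> x))"
    unfolding q2[symmetric] using cexp_lower by (intro sum_mono) (simp add: n_def algebra_simps)
  then have low: "T - A / n \<ge> - (1 / (n - 1)) * (H - Q / n)" by (simp only: sum_distrib_left[symmetric] q1)
  have Qn: "H - Q / n \<ge> 0" unfolding q1[symmetric] by (intro sum_nonneg ip_nonneg)
  have "A - T = (1 - 1 / n) * A - (T - A / n)" by (simp add: algebra_simps)
  also have "\<dots> \<le> (1 - 1 / n) * (2 / ((n - 1) * n) * Q) + 1 / (n - 1) * (H - Q / n)"
    using low mult_left_mono[OF up, of "1 - 1 / n"] n by simp
  also have "(1 - 1 / n) * (2 / ((n - 1) * n) * Q) = 2 / n * (Q / n)" using n by (simp add: field_simps)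
  also have "1 / (n - 1) * (H - Q / n) \<le> 2 / n * (H - Q / n)"
    using n Qn by (intro mult_right_mono) (auto simp: field_simps)
  also have "2 / n * (Q / n) + 2 / n * (H - Q / n) = 2 / n * H"
    by (simp only: distrib_left[symmetric]) simp
  finally show ?thesis unfolding lhs H_def[symmetric] n_def[symmetric] by simp
qed

text \<open>Let \<open>\<phi> x\<close> be the conditional expectation of the centred
  \<open>f\<close> given the occupation of \<open>x\<close>, and \<open>h\<close> the sum of these
  over \<open>x\<close>. Then \<open>h\<close> has inner product \<open>H\<close> with
  \<open>g\<close> and squared norm at most \<open>(1 + 2 / n) * H\<close>, so Cauchy-Schwarz gives
  \<open>H \<le> (1 + 2 / n) * F\<close>. The conditional variances add up to
  \<open>n * F - H\<close>.\<close>

lemma variance_le_site_conditioning: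
  "(1 - (1 + 2 / real (b + 2)) / real (b + 2)) * var_sum (conf S m) f
    \<le> 1 / real (b + 2) * (\<Sum>x\<in>S. \<Sum>k\<le>m. var_sum (conf (S - {x}) (m - k)) (\<lambda>\<zeta>. f (\<zeta> + single x k)))"
proof -
  define n where "n = real (b + 2)"
  have n: "n \<ge> 2" by (simp add: n_def)
  define c where "c = sum f (conf S m) / real (card (conf S m))"
  define g where "g = (\<lambda>\<eta>. f \<eta> - c)"
  define F where "F = (\<Sum>\<eta>\<in>conf S m. (g \<eta>)\<^sup>2)"
  define \<phi> where "\<phi> x = (\<lambda>k. (\<Sum>\<zeta>\<in>conf (S - {x}) (m - k). g (\<zeta> + single x k)) / mc (Suc b) (m - k))" for x
  define H where "H = (\<Sum>x\<in>S. ip b m (\<phi> x) (\<phi> x))"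
  have F: "var_sum (conf S m) f = F" by (simp add: var_sum_def F_def g_def c_def)
  have g0: "sum g (conf S m) = 0"
    using mc_pos[of "b + 2" m] card_conf[OF fin, of m] card by (simp add: g_def sum_subtractf c_def)
  have fb: "finite (conf (S - {x}) l)" for x l using fin by simp
  have inner: "(\<Sum>k\<le>m. var_sum (conf (S - {x}) (m - k)) (\<lambda>\<zeta>. f (\<zeta> + single x k))) = F - ip b m (\<phi> x) (\<phi> x)"
    if x: "x \<in> S" for x
  proof -
    have "(\<Sum>k\<le>m. var_sum (conf (S - {x}) (m - k)) (\<lambda>\<zeta>. f (\<zeta> + single x k)))
      = (\<Sum>k\<le>m. var_sum (conf (S - {x}) (m - k)) (\<lambda>\<zeta>. g (\<zeta> + single x k)))"
      unfolding g_def var_sum_shift[OF fb] ..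
    also have "\<dots> = F - ip b m (\<phi> x) (\<phi> x)"
      unfolding var_sum_eq[OF fb] sum_subtractf F_def sum_conf_remove[OF fin x] ip_def
    proof (intro arg_cong2[where f="(-)"] refl sum.cong)
      fix k
      have "mc (Suc b) (m - k) > 0" by (simp add: mc_pos)
      then show "(\<Sum>\<zeta>\<in>conf (S - {x}) (m - k). g (\<zeta> + single x k))\<^sup>2 / real (card (conf (S - {x}) (m - k))) =
         mc (Suc b) (m - k) * \<phi> x k * \<phi> x k"
        using card_conf_remove[OF x, of "m-k"] by (simp add: \<phi>_def power2_eq_square)
    qed
    finally show ?thesis .
  qed
  have one: "ip b m (\<phi> x) (\<lambda>_. 1) = 0" if "x \<in> S" for x
    using sum_conf_site_fun[OF that, of "\<lambda>_. 1" g] g0 by (simp add: \<phi>_def ip_commute)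
  define h where "h = (\<lambda>\<eta>. \<Sum>x\<in>S. \<phi> x (\<eta> x))"
  have hg: "(\<Sum>\<eta>\<in>conf S m. h \<eta> * g \<eta>) = H"
    unfolding h_def sum_distrib_right H_def
    by (subst sum.swap, rule sum.cong[OF refl]) (rule sum_conf_site_fun[of _ "\<phi> _" g, folded \<phi>_def])
  have hh: "(\<Sum>\<eta>\<in>conf S m. (h \<eta>)\<^sup>2) \<le> (1 + 2 / n) * H"
    using cexp_off_diagonal[of \<phi>, OF one] unfolding h_def sum_square_site_funs H_def n_def
    by (simp add: algebra_simps)
  have F0: "F \<ge> 0" by (simp add: F_def sum_nonneg)
  have H0: "H \<ge> 0" unfolding H_def by (intro sum_nonneg ip_nonneg)
  have "H\<^sup>2 \<le> (\<Sum>\<eta>\<in>conf S m. (h \<eta>)\<^sup>2) * F"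
    unfolding hg[symmetric] F_def by (rule Cauchy_Schwarz_ineq_sum)
  also have "\<dots> \<le> (1 + 2 / n) * H * F" by (rule mult_right_mono[OF hh F0])
  finally have "H * H \<le> H * ((1 + 2 / n) * F)" by (simp add: power2_eq_square mult_ac)
  then have HF: "H \<le> (1 + 2 / n) * F"
    using H0 F0 n by (cases "H = 0") auto
  have "(1 - (1 + 2 / n) / n) * F = 1 / n * (n * F - (1 + 2 / n) * F)" using n by (simp add: field_simps)
  also have "\<dots> \<le> 1 / n * (n * F - H)" using HF n by (intro mult_left_mono) auto
  also have "n * F - H = (\<Sum>x\<in>S. F - ip b m (\<phi> x) (\<phi> x))"
    using card by (simp add: sum_subtractf H_def n_def)
  also have "\<dots> = (\<Sum>x\<in>S. \<Sum>k\<le>m. var_sum (conf (S - {x}) (m - k)) (\<lambda>\<zeta>. f (\<zeta> + single x k)))"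
    using inner by simp
  finally show ?thesis unfolding F n_def .
qed

end

section \<open>Reduction to resampling a random pair of sites\<close>

definition pair_var :: "'a set \<Rightarrow> 'a \<Rightarrow> 'a \<Rightarrow> nat \<Rightarrow> (('a \<Rightarrow> nat) \<Rightarrow> real) \<Rightarrow> real" where
  "pair_var S y z m f = (\<Sum>k\<le>m. \<Sum>\<zeta>\<in>conf (S - {y, z}) (m - k). var_sum (conf {y, z} k) (\<lambda>\<omega>. f (\<zeta> + \<omega>)))"

text \<open>Revealing the occupation of a third site before the rest of the configuration off the
  pair changes only the order of summation.\<close>

lemma pair_var_condition:
  assumes "finite S" "x \<in> S" "x \<noteq> y" "x \<noteq> z"
  shows "(\<Sum>k\<le>m. pair_var (S - {x}) y z (m - k) (\<lambda>\<zeta>. f (\<zeta> + single x k))) = pair_var S y z m f"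
proof -
  have x: "x \<in> S - {y, z}" and fin: "finite (S - {y, z})" using assms by auto
  have eq: "S - {x} - {y, z} = S - {y, z} - {x}" by auto
  have "pair_var S y z m f = (\<Sum>l\<le>m. \<Sum>k\<le>m - l. \<Sum>\<zeta>\<in>conf (S - {y, z} - {x}) (m - l - k).
      var_sum (conf {y, z} l) (\<lambda>\<omega>. f (\<zeta> + single x k + \<omega>)))"
    unfolding pair_var_def sum_conf_remove[OF fin x] ..
  also have "\<dots> = (\<Sum>k\<le>m. \<Sum>l\<le>m - k. \<Sum>\<zeta>\<in>conf (S - {y, z} - {x}) (m - l - k).
      var_sum (conf {y, z} l) (\<lambda>\<omega>. f (\<zeta> + single x k + \<omega>)))"
    by (rule triangle_swap)
  also have "\<dots> = (\<Sum>k\<le>m. pair_var (S - {x}) y z (m - k) (\<lambda>\<zeta>. f (\<zeta> + single x k)))"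
    unfolding pair_var_def eq by (simp add: ac_simps)
  finally show ?thesis by simp
qed

lemma sum_remove_if: "finite S \<Longrightarrow> (\<Sum>y\<in>S - {x}. g y) = (\<Sum>y\<in>S. if y \<noteq> x then g y else (0::'c::comm_monoid_add))"
  by (rule sum.mono_neutral_cong_left) auto

text \<open>An ordered pair of distinct sites has \<open>card S - 2\<close> choices of a third one;
  for fewer than three sites both sides vanish.\<close>

lemma sum_distinct_triples:
  fixes c :: "'a \<Rightarrow> 'a \<Rightarrow> real"
  assumes fin: "finite S"
  shows "(\<Sum>x\<in>S. \<Sum>y\<in>S - {x}. \<Sum>z\<in>S - {x} - {y}. c y z) = (real (card S) - 2) * (\<Sum>y\<in>S. \<Sum>z\<in>S - {y}. c y z)"
proof -
  have "(\<Sum>x\<in>S. \<Sum>y\<in>S - {x}. \<Sum>z\<in>S - {x} - {y}. c y z)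
    = (\<Sum>x\<in>S. \<Sum>y\<in>S. \<Sum>z\<in>S. if y \<noteq> x then if z \<noteq> y then if z \<noteq> x then c y z else 0 else 0 else 0)"
    using fin by (simp add: sum_remove_if if_distrib[of "\<lambda>t. sum t _"] cong: if_cong) (auto intro!: sum.cong)
  also have "\<dots> = (\<Sum>y\<in>S. \<Sum>z\<in>S. \<Sum>x\<in>S. if y \<noteq> x then if z \<noteq> y then if z \<noteq> x then c y z else 0 else 0 else 0)"
    by (subst sum.swap, rule sum.cong[OF refl], rule sum.swap)
  also have "\<dots> = (\<Sum>y\<in>S. \<Sum>z\<in>S. if z \<noteq> y then (real (card S) - 2) * c y z else 0)"
  proof (intro sum.cong refl)
    fix y z assume yz: "y \<in> S" "z \<in> S"
    show "(\<Sum>x\<in>S. if y \<noteq> x then if z \<noteq> y then if z \<noteq> x then c y z else 0 else 0 else 0)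
      = (if z \<noteq> y then (real (card S) - 2) * c y z else 0)"
    proof (cases "z = y")
      case False
      have "(\<Sum>x\<in>S. if y \<noteq> x then if z \<noteq> y then if z \<noteq> x then c y z else 0 else 0 else 0)
         = (\<Sum>x\<in>S - {y, z}. c y z)"
        using fin False by (intro sum.mono_neutral_cong_right) auto
      also have "\<dots> = real (card (S - {y, z})) * c y z" by simp
      also have "real (card (S - {y, z})) = real (card S) - 2"
      proof -
        have "card {y, z} \<le> card S" using fin yz by (intro card_mono) auto
        then show ?thesis using fin yz False by (simp add: card_Diff_subset)
      qed
      finally show ?thesis using False by simp
    qed (simp cong: if_cong)
  qed
  also have "\<dots> = (real (card S) - 2) * (\<Sum>y\<in>S. \<Sum>z\<in>S - {y}. c y z)"
    by (simp add: sum_remove_if[OF fin] sum_distrib_left if_distrib cong: if_cong)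
  finally show ?thesis .
qed

text \<open>With \<open>n\<close> sites and constant \<open>c n\<close>, conditioning on one site
  gives \<open>c n = n / (n + 1) * c (n - 1)\<close>, because
  \<open>1 - (1 + 2 / n) / n = (n - 2) * (n + 1) / n\<^sup>2\<close>. For \<open>n = 2\<close> each
  of the two ordered pairs already carries the full variance, so \<open>c 2 = 1 / 2\<close> and the
  product telescopes to \<open>3 / (2 * (n + 1))\<close>.\<close>

theorem variance_le_pair_variances:
  assumes "finite S" "card S = b + 2"
  shows "var_sum (conf S m) f \<le> 3 / (2 * real (b + 3)) * (\<Sum>y\<in>S. \<Sum>z\<in>S - {y}. pair_var S y z m f)"
  using assms
proof (induction b arbitrary: S m f)
  case 0
  then obtain y z where S: "S = {y, z}" "y \<noteq> z" by (metis add_0 card_2_iff)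
  have "pair_var {y, z} y' z' m f = var_sum (conf {y, z} m) f" if "{y', z'} = {y, z}" for y' z'
  proof -
    have "pair_var {y, z} y' z' m f = (\<Sum>k\<le>m. if k = m then var_sum (conf {y, z} m) f else 0)"
      unfolding pair_var_def that by (intro sum.cong) (auto simp: conf_empty)
    then show ?thesis by simp
  qed
  then have "pair_var {y, z} y z m f = var_sum (conf {y, z} m) f" "pair_var {y, z} z y m f = var_sum (conf {y, z} m) f"
    by (simp_all add: insert_commute)
  moreover have "{y, z} - {y} = {z}" "{y, z} - {z} = {y}" using S by auto
  ultimately show ?case using S by simp
next
  case (Suc b)
  define n where "n = real (b + 3)"
  have n: "n \<ge> 3" by (simp add: n_def)
  have cS: "card S = Suc b + 2" and fin: "finite S" using Suc.prems by auto
  define P where "P = (\<Sum>y\<in>S. \<Sum>z\<in>S - {y}. pair_var S y z m f)"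
  define V where "V = var_sum (conf S m) f"
  have "(1 - (1 + 2 / n) / n) * V
    \<le> 1 / n * (\<Sum>x\<in>S. \<Sum>k\<le>m. var_sum (conf (S - {x}) (m - k)) (\<lambda>\<zeta>. f (\<zeta> + single x k)))"
    using variance_le_site_conditioning[OF fin cS, of m f] by (simp add: n_def V_def add.commute)
  also have "\<dots> \<le> 1 / n * (\<Sum>x\<in>S. \<Sum>k\<le>m. 3 / (2 * n) * (\<Sum>y\<in>S - {x}. \<Sum>z\<in>S - {x} - {y}.
      pair_var (S - {x}) y z (m - k) (\<lambda>\<zeta>. f (\<zeta> + single x k))))"
    unfolding n_def using fin cS by (intro mult_left_mono sum_mono Suc.IH) auto
  also have "\<dots> = 1 / n * (\<Sum>x\<in>S. 3 / (2 * n) * (\<Sum>y\<in>S - {x}. \<Sum>z\<in>S - {x} - {y}. pair_var S y z m f))"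
  proof -
    have "(\<Sum>k\<le>m. (\<Sum>y\<in>S - {x}. \<Sum>z\<in>S - {x} - {y}. pair_var (S - {x}) y z (m - k) (\<lambda>\<zeta>. f (\<zeta> + single x k))))
      = (\<Sum>y\<in>S - {x}. \<Sum>z\<in>S - {x} - {y}. pair_var S y z m f)" if x: "x \<in> S" for x
    proof -
      have "(\<Sum>k\<le>m. (\<Sum>y\<in>S - {x}. \<Sum>z\<in>S - {x} - {y}. pair_var (S - {x}) y z (m - k) (\<lambda>\<zeta>. f (\<zeta> + single x k))))
        = (\<Sum>y\<in>S - {x}. \<Sum>z\<in>S - {x} - {y}. \<Sum>k\<le>m. pair_var (S - {x}) y z (m - k) (\<lambda>\<zeta>. f (\<zeta> + single x k)))"
        by (subst sum.swap, rule sum.cong[OF refl], rule sum.swap)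
      also have "\<dots> = (\<Sum>y\<in>S - {x}. \<Sum>z\<in>S - {x} - {y}. pair_var S y z m f)"
        by (intro sum.cong refl pair_var_condition[OF fin x]) auto
      finally show ?thesis .
    qed
    then show ?thesis
      by (intro arg_cong[where f="\<lambda>t. 1 / n * t"] sum.cong refl) (simp only: sum_distrib_left[symmetric])
  qed
  also have "\<dots> = 1 / n * (3 / (2 * n) * ((n - 2) * P))"
    unfolding sum_distrib_left[symmetric] sum_distinct_triples[OF fin] P_def using cS by (simp add: n_def add.commute)
  finally have main: "(1 - (1 + 2 / n) / n) * V \<le> 1 / n * (3 / (2 * n) * ((n - 2) * P))" .
  have "(n - 2) * ((n + 1) * V) = n\<^sup>2 * ((1 - (1 + 2 / n) / n) * V)"
    using n by (simp add: field_simps power2_eq_square)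
  also have "\<dots> \<le> n\<^sup>2 * (1 / n * (3 / (2 * n) * ((n - 2) * P)))"
    by (rule mult_left_mono[OF main]) simp
  also have "\<dots> = (n - 2) * (3 / 2 * P)" using n by (simp add: field_simps power2_eq_square)
  finally have "(n + 1) * V \<le> 3 / 2 * P" using n by (simp add: mult_le_cancel_left)
  then have "V \<le> 3 / (2 * (n + 1)) * P" using n by (simp add: field_simps)
  then show ?case by (simp add: V_def P_def n_def algebra_simps)
qed

section \<open>Resampling a pair by single-particle moves\<close>

text \<open>The argument \<open>r\<close> counts the background \<open>\<xi>\<close> without the
  moving particle, so this is an energy of functions of \<open>Suc r\<close> particles.\<close>

definition edge :: "'a set \<Rightarrow> nat \<Rightarrow> (('a \<Rightarrow> nat) \<Rightarrow> real) \<Rightarrow> 'a \<Rightarrow> 'a \<Rightarrow> real" where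
  "edge S r f x y = (\<Sum>\<xi>\<in>conf S r. (f (\<xi> + single x 1) - f (\<xi> + single y 1))\<^sup>2)"

lemma edge_nonneg: "edge S r f x y \<ge> 0"
  by (simp add: edge_def sum_nonneg)

lemma edge_commute: "edge S r f x y = edge S r f y x"
  by (simp add: edge_def power2_commute)

lemma telescope_square:
  fixes \<phi> :: "nat \<Rightarrow> real"
  shows "(\<phi> j - \<phi> 0)\<^sup>2 \<le> real j * (\<Sum>i<j. (\<phi> (Suc i) - \<phi> i)\<^sup>2)"
  using sum_squared_le_sum_of_squares[of "\<lambda>i. \<phi> (Suc i) - \<phi> i" "{..<j}"]
  by (simp add: sum_lessThan_telescope mult.commute)

lemma conf_add_single: "finite S \<Longrightarrow> x \<in> S \<Longrightarrow> \<eta> \<in> conf S m \<Longrightarrow> \<eta> + single x k \<in> conf S (m + k)"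
  by (auto simp: conf_def sum.distrib)

lemma sum_le_sum_inj_image:
  fixes g :: "'b \<Rightarrow> real"
  assumes "finite B" "inj_on h A" "h ` A \<subseteq> B" "\<And>x. x \<in> B \<Longrightarrow> g x \<ge> 0"
  shows "(\<Sum>x\<in>A. g (h x)) \<le> (\<Sum>x\<in>B. g x)"
proof -
  have "(\<Sum>x\<in>A. g (h x)) = sum g (h ` A)" using assms by (simp add: sum.reindex)
  also have "\<dots> \<le> sum g B" using assms by (intro sum_mono2) auto
  finally show ?thesis .
qed

text \<open>Move the \<open>M\<close> particles one at a time. Cauchy-Schwarz costs one factor
  \<open>M\<close>. At each of the \<open>M\<close> stages the background determines
  \<open>\<tau>\<close>, so the stage costs at most one \<open>edge\<close>, which gives the second
  factor.\<close>

lemma block_move_le_edge: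
  assumes fin: "finite S" and yu: "y \<in> S" "u \<in> S"
  shows "(\<Sum>\<tau>\<in>conf S l. (f (\<tau> + single y M) - f (\<tau> + single u M))\<^sup>2) \<le> (real M)\<^sup>2 * edge S (l + M - 1) f y u"
proof -
  define \<phi> where "\<phi> \<tau> i = f (\<tau> + single u i + single y (M - i))" for \<tau> i
  have s0: "\<tau> + single x 0 = \<tau>" for \<tau> and x :: 'a by (auto simp: fun_eq_iff)
  have "(\<Sum>\<tau>\<in>conf S l. (f (\<tau> + single y M) - f (\<tau> + single u M))\<^sup>2) = (\<Sum>\<tau>\<in>conf S l. (\<phi> \<tau> M - \<phi> \<tau> 0)\<^sup>2)"
    by (simp add: \<phi>_def s0 power2_commute)
  also have "\<dots> \<le> (\<Sum>\<tau>\<in>conf S l. real M * (\<Sum>i<M. (\<phi> \<tau> (Suc i) - \<phi> \<tau> i)\<^sup>2))"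
    by (intro sum_mono telescope_square)
  also have "\<dots> = real M * (\<Sum>i<M. \<Sum>\<tau>\<in>conf S l. (\<phi> \<tau> (Suc i) - \<phi> \<tau> i)\<^sup>2)"
    by (simp add: sum_distrib_left) (rule sum.swap)
  also have "\<dots> \<le> real M * (\<Sum>i<M. edge S (l + M - 1) f y u)"
  proof (intro mult_left_mono sum_mono)
    fix i assume "i \<in> {..<M}"
    then have i: "i < M" by simp
    \<comment> \<open>The background of stage \<open>i\<close> omits the particle in motion, which
      leaves \<open>l + M - 1\<close> particles.\<close>
    define h where "h \<tau> = \<tau> + (single u i + single y (M - Suc i))" for \<tau>
    have a: "\<phi> \<tau> (Suc i) = f (h \<tau> + single u 1)" for \<tau>
      by (simp add: \<phi>_def h_def add.assoc, rule arg_cong[where f=f]) (auto simp: fun_eq_iff)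
    have b: "\<phi> \<tau> i = f (h \<tau> + single y 1)" for \<tau>
      using i by (simp add: \<phi>_def h_def add.assoc, intro arg_cong[where f=f]) (auto simp: fun_eq_iff)
    have "(\<Sum>\<tau>\<in>conf S l. (\<phi> \<tau> (Suc i) - \<phi> \<tau> i)\<^sup>2) = (\<Sum>\<tau>\<in>conf S l. (f (h \<tau> + single y 1) - f (h \<tau> + single u 1))\<^sup>2)"
      by (simp add: a b power2_commute)
    also have "\<dots> \<le> edge S (l + M - 1) f y u" unfolding edge_def
    proof (rule sum_le_sum_inj_image)
      show "inj_on h (conf S l)" by (auto simp: inj_on_def h_def)
      show "h ` conf S l \<subseteq> conf S (l + M - 1)"
      proof (rule image_subsetI)
        fix \<tau> assume "\<tau> \<in> conf S l"
        then have "\<tau> + single u i + single y (M - Suc i) \<in> conf S (l + i + (M - Suc i))"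
          using fin yu by (intro conf_add_single)
        then show "h \<tau> \<in> conf S (l + M - 1)" using i by (simp add: h_def add.assoc)
      qed
    qed (use fin in auto)
    finally show "(\<Sum>\<tau>\<in>conf S l. (\<phi> \<tau> (Suc i) - \<phi> \<tau> i)\<^sup>2) \<le> edge S (l + M - 1) f y u" .
  qed simp
  also have "\<dots> = (real M)\<^sup>2 * edge S (l + M - 1) f y u" by (simp add: power2_eq_square)
  finally show ?thesis .
qed

lemma sum_conf_pair:
  assumes "y \<noteq> z"
  shows "(\<Sum>\<omega>\<in>conf {y, z} k. g \<omega>) = (\<Sum>j\<le>k. g (single z (k - j) + single y j) :: 'c :: comm_monoid_add)"
proof -
  have "{y, z} - {y} = {z}" using assms by auto
  then show ?thesis using sum_conf_remove[of "{y, z}" y g k] by (simp add: conf_singleton)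
qed

text \<open>Configurations on two sites form a path. Compare each point with the endpoint having no
  particle at \<open>y\<close>: there are \<open>Suc k\<close> nonzero terms, each at distance at
  most \<open>Suc k\<close>.\<close>

lemma pair_var_sum_path:
  assumes yz: "y \<noteq> z"
  shows "var_sum (conf {y, z} (Suc k)) g
    \<le> (real (Suc k))\<^sup>2 * (\<Sum>\<omega>\<in>conf {y, z} k. (g (\<omega> + single y 1) - g (\<omega> + single z 1))\<^sup>2)"
proof -
  define \<phi> where "\<phi> j = g (single z (Suc k - j) + single y j)" for j
  define D where "D = (\<Sum>i<Suc k. (\<phi> (Suc i) - \<phi> i)\<^sup>2)"
  have "var_sum (conf {y, z} (Suc k)) g \<le> (\<Sum>\<omega>\<in>conf {y, z} (Suc k). (g \<omega> - \<phi> 0)\<^sup>2)"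
    by (rule var_sum_le) simp
  also have "\<dots> = (\<Sum>j\<le>Suc k. (\<phi> j - \<phi> 0)\<^sup>2)" unfolding sum_conf_pair[OF yz] \<phi>_def ..
  also have "\<dots> = (\<Sum>j\<le>k. (\<phi> (Suc j) - \<phi> 0)\<^sup>2)" by (subst sum.atMost_Suc_shift) simp
  also have "\<dots> \<le> (\<Sum>j\<le>k. real (Suc k) * D)"
  proof (rule sum_mono)
    fix j assume j: "j \<in> {..k}"
    have "(\<phi> (Suc j) - \<phi> 0)\<^sup>2 \<le> real (Suc j) * (\<Sum>i<Suc j. (\<phi> (Suc i) - \<phi> i)\<^sup>2)" by (rule telescope_square)
    also have "\<dots> \<le> real (Suc k) * D"
      unfolding D_def using j by (intro mult_mono sum_mono2) (auto intro: sum_nonneg simp del: sum.lessThan_Suc)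
    finally show "(\<phi> (Suc j) - \<phi> 0)\<^sup>2 \<le> real (Suc k) * D" .
  qed
  also have "\<dots> = (real (Suc k))\<^sup>2 * D" by (simp add: power2_eq_square)
  also have "D = (\<Sum>\<omega>\<in>conf {y, z} k. (g (\<omega> + single y 1) - g (\<omega> + single z 1))\<^sup>2)"
    unfolding sum_conf_pair[OF yz] D_def lessThan_Suc_atMost
  proof (rule sum.cong[OF refl])
    fix i assume i: "i \<in> {..k}"
    have "single z (Suc k - Suc i) + single y (Suc i) = single z (k - i) + single y i + single y 1"
      by (auto simp: fun_eq_iff)
    moreover have "single z (Suc k - i) + single y i = single z (k - i) + single y i + single z 1"
      using i by (auto simp: fun_eq_iff)
    ultimately show "(\<phi> (Suc i) - \<phi> i)\<^sup>2 = (g (single z (k - i) + single y i + single y 1) - g (single z (k - i) + single y i + single z 1))\<^sup>2"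
      by (simp only: \<phi>_def)
  qed
  finally show ?thesis .
qed

text \<open>With at least \<open>2 * M\<close> particles on the pair, one of its sites holds at
  least \<open>M\<close>, so a block of \<open>M\<close> can be split off at \<open>y\<close> or at
  \<open>z\<close>.\<close>

lemma sum_conf_pair_high:
  fixes g :: "('a \<Rightarrow> nat) \<Rightarrow> real"
  assumes yz: "y \<noteq> z" and g: "\<And>\<omega>. g \<omega> \<ge> 0" and k: "M \<le> k"
  shows "(\<Sum>\<omega>\<in>conf {y, z} (k + M). g \<omega>) \<le> (\<Sum>\<omega>\<in>conf {y, z} k. g (\<omega> + single y M) + g (\<omega> + single z M))"
proof -
  have "conf {y, z} (k + M) \<subseteq> (\<lambda>\<omega>. \<omega> + single y M) ` conf {y, z} k \<union> (\<lambda>\<omega>. \<omega> + single z M) ` conf {y, z} k"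
  proof
    fix \<omega> assume w: "\<omega> \<in> conf {y, z} (k + M)"
    then have sum: "\<omega> y + \<omega> z = k + M" using yz by (simp add: conf_def)
    show "\<omega> \<in> (\<lambda>\<omega>. \<omega> + single y M) ` conf {y, z} k \<union> (\<lambda>\<omega>. \<omega> + single z M) ` conf {y, z} k"
    proof (cases "M \<le> \<omega> y")
      case True
      have "\<omega> = \<omega>(y := \<omega> y - M) + single y M" using True by (auto simp: fun_eq_iff)
      moreover have "\<omega>(y := \<omega> y - M) \<in> conf {y, z} k" using w sum True yz by (auto simp: conf_def)
      ultimately show ?thesis by blast
    next
      case False
      have M: "M \<le> \<omega> z" using False sum k by simp
      have "\<omega> = \<omega>(z := \<omega> z - M) + single z M" using M by (auto simp: fun_eq_iff)
      moreover have "\<omega>(z := \<omega> z - M) \<in> conf {y, z} k" using w sum M yz by (auto simp: conf_def)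
      ultimately show ?thesis by blast
    qed
  qed
  then have "sum g (conf {y, z} (k + M))
    \<le> sum g ((\<lambda>\<omega>. \<omega> + single y M) ` conf {y, z} k \<union> (\<lambda>\<omega>. \<omega> + single z M) ` conf {y, z} k)"
    using g by (intro sum_mono2) auto
  also have "\<dots> \<le> sum g ((\<lambda>\<omega>. \<omega> + single y M) ` conf {y, z} k) + sum g ((\<lambda>\<omega>. \<omega> + single z M) ` conf {y, z} k)"
    using g by (simp add: sum_Un sum_nonneg)
  also have "\<dots> = (\<Sum>\<omega>\<in>conf {y, z} k. g (\<omega> + single y M) + g (\<omega> + single z M))"
    by (simp add: sum.reindex inj_on_def sum.distrib)
  finally show ?thesis .
qed

lemma two_square: "((a::real) - c)\<^sup>2 \<le> 2 * (a - b)\<^sup>2 + 2 * (b - c)\<^sup>2"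
  using zero_le_power2[of "(a - b) - (b - c)"] by (simp add: power2_eq_square algebra_simps)

text \<open>Take the deviations about the mean \<open>c\<close> of the configurations whose block
  has been dumped on \<open>u\<close>. The triangle inequality for squares, once for a block from
  \<open>y\<close> and once for a block from \<open>z\<close>, yields the factors 2 and 4.\<close>

lemma pair_var_sum_dump:
  assumes yz: "y \<noteq> z" and k: "M \<le> k"
  shows "var_sum (conf {y, z} (k + M)) (\<lambda>\<omega>. f (\<zeta> + \<omega>))
    \<le> 2 * (\<Sum>\<omega>\<in>conf {y, z} k. (f (\<zeta> + \<omega> + single y M) - f (\<zeta> + \<omega> + single u M))\<^sup>2
              + (f (\<zeta> + \<omega> + single z M) - f (\<zeta> + \<omega> + single u M))\<^sup>2)
      + 4 * var_sum (conf {y, z} k) (\<lambda>\<omega>. f (\<zeta> + single u M + \<omega>))"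
proof -
  define c where "c = (\<Sum>\<omega>\<in>conf {y, z} k. f (\<zeta> + single u M + \<omega>)) / real (card (conf {y, z} k))"
  define F where "F \<omega> = f (\<zeta> + \<omega> + single u M)" for \<omega>
  have F: "f (\<zeta> + single u M + \<omega>) = F \<omega>" for \<omega> by (simp add: F_def add_ac)
  have "var_sum (conf {y, z} (k + M)) (\<lambda>\<omega>. f (\<zeta> + \<omega>)) \<le> (\<Sum>\<omega>\<in>conf {y, z} (k + M). (f (\<zeta> + \<omega>) - c)\<^sup>2)"
    by (rule var_sum_le) simp
  also have "\<dots> \<le> (\<Sum>\<omega>\<in>conf {y, z} k. (f (\<zeta> + (\<omega> + single y M)) - c)\<^sup>2 + (f (\<zeta> + (\<omega> + single z M)) - c)\<^sup>2)"
    using sum_conf_pair_high[OF yz _ k, of "\<lambda>\<omega>. (f (\<zeta> + \<omega>) - c)\<^sup>2"] by simp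
  also have "\<dots> \<le> (\<Sum>\<omega>\<in>conf {y, z} k. 2 * ((f (\<zeta> + \<omega> + single y M) - F \<omega>)\<^sup>2 + (f (\<zeta> + \<omega> + single z M) - F \<omega>)\<^sup>2)
      + 4 * (F \<omega> - c)\<^sup>2)"
  proof (rule sum_mono)
    fix \<omega>
    show "(f (\<zeta> + (\<omega> + single y M)) - c)\<^sup>2 + (f (\<zeta> + (\<omega> + single z M)) - c)\<^sup>2
      \<le> 2 * ((f (\<zeta> + \<omega> + single y M) - F \<omega>)\<^sup>2 + (f (\<zeta> + \<omega> + single z M) - F \<omega>)\<^sup>2) + 4 * (F \<omega> - c)\<^sup>2"
      using two_square[of "f (\<zeta> + \<omega> + single y M)" c "F \<omega>"] two_square[of "f (\<zeta> + \<omega> + single z M)" c "F \<omega>"]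
      by (simp add: add.assoc)
  qed
  also have "\<dots> = 2 * (\<Sum>\<omega>\<in>conf {y, z} k. (f (\<zeta> + \<omega> + single y M) - F \<omega>)\<^sup>2 + (f (\<zeta> + \<omega> + single z M) - F \<omega>)\<^sup>2)
      + 4 * (\<Sum>\<omega>\<in>conf {y, z} k. (F \<omega> - c)\<^sup>2)"
    by (subst sum.distrib) (simp only: sum_distrib_left)
  also have "(\<Sum>\<omega>\<in>conf {y, z} k. (F \<omega> - c)\<^sup>2) = var_sum (conf {y, z} k) (\<lambda>\<omega>. f (\<zeta> + single u M + \<omega>))"
    by (simp add: var_sum_def F c_def)
  finally show ?thesis by (simp only: F_def)
qed

text \<open>Markov's inequality: dumping on \<open>u\<close> is injective and leaves at least
  \<open>M\<close> particles there, while the occupation numbers of \<open>\<zeta>\<close> add up to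
  \<open>l + M\<close>.\<close>

lemma sum_conf_dumped:
  fixes W :: "('a \<Rightarrow> nat) \<Rightarrow> real"
  assumes fin: "finite R" and W: "\<And>\<zeta>. W \<zeta> \<ge> 0" and M: "M > 0"
  shows "real M * (\<Sum>u\<in>R. \<Sum>\<zeta>\<in>conf R l. W (\<zeta> + single u M)) \<le> real (l + M) * (\<Sum>\<zeta>\<in>conf R (l + M). W \<zeta>)"
proof -
  have "(\<Sum>\<zeta>\<in>conf R l. W (\<zeta> + single u M)) \<le> (\<Sum>\<zeta>\<in>conf R (l + M). if M \<le> \<zeta> u then W \<zeta> else 0)" if u: "u \<in> R" for u
  proof -
    have "(\<Sum>\<zeta>\<in>conf R l. W (\<zeta> + single u M)) = (\<Sum>\<zeta>\<in>conf R l. if M \<le> (\<zeta> + single u M) u then W (\<zeta> + single u M) else 0)" by simp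
    also have "\<dots> \<le> (\<Sum>\<zeta>\<in>conf R (l + M). if M \<le> \<zeta> u then W \<zeta> else 0)"
      using fin u W by (intro sum_le_sum_inj_image[where h="\<lambda>\<zeta>. \<zeta> + single u M"])
        (auto simp: inj_on_def intro: conf_add_single)
    finally show ?thesis .
  qed
  then have "real M * (\<Sum>u\<in>R. \<Sum>\<zeta>\<in>conf R l. W (\<zeta> + single u M))
    \<le> real M * (\<Sum>u\<in>R. \<Sum>\<zeta>\<in>conf R (l + M). if M \<le> \<zeta> u then W \<zeta> else 0)"
    by (intro mult_left_mono sum_mono) auto
  also have "\<dots> = (\<Sum>\<zeta>\<in>conf R (l + M). \<Sum>u\<in>R. real M * (if M \<le> \<zeta> u then W \<zeta> else 0))"
    unfolding sum_distrib_left by (rule sum.swap)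
  also have "\<dots> \<le> (\<Sum>\<zeta>\<in>conf R (l + M). real (l + M) * W \<zeta>)"
  proof (rule sum_mono)
    fix \<zeta> assume z: "\<zeta> \<in> conf R (l + M)"
    have "(\<Sum>u\<in>R. real M * (if M \<le> \<zeta> u then W \<zeta> else 0)) \<le> (\<Sum>u\<in>R. real (\<zeta> u) * W \<zeta>)"
      using W[of \<zeta>] by (intro sum_mono) (auto intro: mult_right_mono)
    also have "\<dots> = real (l + M) * W \<zeta>" using z by (simp add: conf_def flip: sum_distrib_right of_nat_sum)
    finally show "(\<Sum>u\<in>R. real M * (if M \<le> \<zeta> u then W \<zeta> else 0)) \<le> real (l + M) * W \<zeta>" .
  qed
  finally show ?thesis by (simp add: sum_distrib_left)
qed

text \<open>Split by the number \<open>k\<close> of particles on the pair. Below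
  \<open>2 * M\<close> a path suffices; from \<open>2 * M\<close> on, dump a block on
  \<open>u\<close> and average over all \<open>u\<close> off the pair. By \<open>dense\<close> the
  variance left after the dump is at most \<open>V / 2\<close>; absorbing it doubles the other
  constants.\<close>

lemma pair_var_le_edges:
  assumes fin: "finite S" and y: "y \<in> S" and z: "z \<in> S" and yz: "y \<noteq> z"
    and M: "M > 0" and N: "card (S - {y, z}) > 0" and dense: "8 * Suc r \<le> M * card (S - {y, z})"
  shows "pair_var S y z (Suc r) f \<le> 8 * (real M)\<^sup>2 * edge S r f y z
    + 4 * (real M)\<^sup>2 / real (card (S - {y, z})) * (\<Sum>u\<in>S - {y, z}. edge S r f y u + edge S r f z u)"
proof -
  define R where "R = S - {y, z}"
  define n where "n = real (card R)"
  define m where "m = Suc r"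
  have finR: "finite R" and S: "S = R \<union> {y, z}" and disj: "R \<inter> {y, z} = {}" using fin y z by (auto simp: R_def)
  have fin_pair: "finite {y, z}" by simp
  have n: "n > 0" using N by (simp add: n_def R_def)
  define W where "W k \<zeta> = var_sum (conf {y, z} k) (\<lambda>\<omega>. f (\<zeta> + \<omega>))" for k \<zeta>
  define w where "w k = (\<Sum>\<zeta>\<in>conf R (m - k). W k \<zeta>)" for k
  define V where "V = (\<Sum>k\<le>m. w k)"
  have V: "pair_var S y z (Suc r) f = V" by (simp add: pair_var_def V_def w_def W_def R_def m_def)
  have W0: "W k \<zeta> \<ge> 0" for k \<zeta> by (simp add: W_def var_sum_nonneg)
  have w0: "w k \<ge> 0" for k by (simp add: w_def W0 sum_nonneg)
  have V0: "V \<ge> 0" by (simp add: V_def w0 sum_nonneg)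
  have split: "V = (\<Sum>k\<le>m. if k < 2 * M then w k else 0) + (\<Sum>k\<le>m. if 2 * M \<le> k then w k else 0)"
    unfolding V_def sum.distrib[symmetric] by (intro sum.cong) auto
  have low: "(\<Sum>k\<le>m. if k < 2 * M then w k else 0) \<le> 4 * (real M)\<^sup>2 * edge S r f y z"
  proof -
    have "w 0 = 0"
    proof -
      have "W 0 \<zeta> = 0" for \<zeta> using card_conf[OF fin_pair, of 0]
        by (simp add: W_def var_sum_def sum_conf_pair[OF yz])
      then show ?thesis by (simp add: w_def)
    qed
    then have "(\<Sum>k\<le>m. if k < 2 * M then w k else 0) = (\<Sum>k\<le>r. if Suc k < 2 * M then w (Suc k) else 0)"
      unfolding m_def by (subst sum.atMost_Suc_shift) simp
    also have "\<dots> \<le> (\<Sum>k\<le>r. \<Sum>\<zeta>\<in>conf R (r - k). (2 * real M)\<^sup>2 *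
        (\<Sum>\<omega>\<in>conf {y, z} k. (f (\<zeta> + \<omega> + single y 1) - f (\<zeta> + \<omega> + single z 1))\<^sup>2))"
    proof (rule sum_mono)
      fix k assume "k \<in> {..r}"
      let ?D = "\<lambda>\<zeta>. \<Sum>\<omega>\<in>conf {y, z} k. (f (\<zeta> + \<omega> + single y 1) - f (\<zeta> + \<omega> + single z 1))\<^sup>2"
      have D0: "?D \<zeta> \<ge> 0" for \<zeta> by (simp add: sum_nonneg)
      show "(if Suc k < 2 * M then w (Suc k) else 0) \<le> (\<Sum>\<zeta>\<in>conf R (r - k). (2 * real M)\<^sup>2 * ?D \<zeta>)"
      proof (cases "Suc k < 2 * M")
        case True
        have "W (Suc k) \<zeta> \<le> (2 * real M)\<^sup>2 * ?D \<zeta>" for \<zeta>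
        proof -
          have "W (Suc k) \<zeta> \<le> (real (Suc k))\<^sup>2 * ?D \<zeta>"
            using pair_var_sum_path[OF yz, of k "\<lambda>\<omega>. f (\<zeta> + \<omega>)"] by (simp add: W_def add.assoc del: of_nat_Suc)
          also have "\<dots> \<le> (2 * real M)\<^sup>2 * ?D \<zeta>" using True by (intro mult_right_mono[OF _ D0] power_mono) auto
          finally show ?thesis .
        qed
        then show ?thesis using True by (simp add: w_def m_def sum_mono)
      next
        case False
        then show ?thesis using D0 by (simp add: sum_nonneg)
      qed
    qed
    also have "\<dots> = (2 * real M)\<^sup>2 * (\<Sum>k\<le>r. \<Sum>\<zeta>\<in>conf R (r - k).
        \<Sum>\<omega>\<in>conf {y, z} k. (f (\<zeta> + \<omega> + single y 1) - f (\<zeta> + \<omega> + single z 1))\<^sup>2)"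
      by (simp only: sum_distrib_left)
    also have "\<dots> = (2 * real M)\<^sup>2 * edge S r f y z"
      unfolding edge_def by (subst S, subst sum_conf_Un[OF finR fin_pair disj]) (rule refl)
    also have "\<dots> = 4 * (real M)\<^sup>2 * edge S r f y z" by (simp add: power_mult_distrib)
    finally show ?thesis .
  qed
  define B where "B = (\<Sum>u\<in>R. edge S r f y u + edge S r f z u)"
  have B0: "B \<ge> 0" by (simp add: B_def sum_nonneg edge_nonneg)
  have high: "n * (\<Sum>k\<le>m. if 2 * M \<le> k then w k else 0) \<le> 2 * (real M)\<^sup>2 * B + n / 2 * V"
  proof (cases "2 * M \<le> m")
    case False
    then have "(\<Sum>k\<le>m. if 2 * M \<le> k then w k else 0) = 0" by (intro sum.neutral) auto
    then show ?thesis using B0 V0 n by simp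
  next
    case True
    define l where "l = m - M"
    have l: "m = l + M" "M \<le> l" using True by (auto simp: l_def)
    define X where "X u = (\<Sum>k\<le>l. \<Sum>\<zeta>\<in>conf R (l - k). W k (\<zeta> + single u M))" for u
    \<comment> \<open>The index now counts what the pair keeps after the dump, namely between
      \<open>M\<close> and \<open>l\<close> particles.\<close>
    have "(\<Sum>k\<le>m. if 2 * M \<le> k then w k else 0) = sum w {M + M..l + M}"
      by (rule sum.mono_neutral_cong_right) (use l in auto)
    also have "\<dots> = (\<Sum>k=M..l. w (k + M))" by (rule sum.shift_bounds_cl_nat_ivl)
    finally have shift: "(\<Sum>k\<le>m. if 2 * M \<le> k then w k else 0) = (\<Sum>k=M..l. w (k + M))" .
    have each: "(\<Sum>k=M..l. w (k + M)) \<le> 2 * ((real M)\<^sup>2 * (edge S r f y u + edge S r f z u)) + 4 * X u"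
      if u: "u \<in> R" for u
    proof -
      define G where "G \<tau> = (f (\<tau> + single y M) - f (\<tau> + single u M))\<^sup>2 + (f (\<tau> + single z M) - f (\<tau> + single u M))\<^sup>2" for \<tau>
      have G0: "G \<tau> \<ge> 0" for \<tau> by (simp add: G_def)
      have "(\<Sum>k=M..l. w (k + M)) \<le> (\<Sum>k=M..l. \<Sum>\<zeta>\<in>conf R (l - k). 2 * (\<Sum>\<omega>\<in>conf {y, z} k. G (\<zeta> + \<omega>)) + 4 * W k (\<zeta> + single u M))"
      proof (rule sum_mono)
        fix k assume k: "k \<in> {M..l}"
        have "m - (k + M) = l - k" using l by simp
        then show "w (k + M) \<le> (\<Sum>\<zeta>\<in>conf R (l - k). 2 * (\<Sum>\<omega>\<in>conf {y, z} k. G (\<zeta> + \<omega>)) + 4 * W k (\<zeta> + single u M))"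
          unfolding w_def W_def G_def using pair_var_sum_dump[OF yz] k by (auto intro!: sum_mono)
      qed
      \<comment> \<open>Admitting all \<open>k \<le> l\<close> lets the inner sums recombine into
        one sum over \<open>conf S l\<close>.\<close>
      also have "\<dots> \<le> (\<Sum>k\<le>l. \<Sum>\<zeta>\<in>conf R (l - k). 2 * (\<Sum>\<omega>\<in>conf {y, z} k. G (\<zeta> + \<omega>)) + 4 * W k (\<zeta> + single u M))"
        by (intro sum_mono2) (auto intro!: sum_nonneg add_nonneg_nonneg G0 W0)
      also have "\<dots> = 2 * (\<Sum>k\<le>l. \<Sum>\<zeta>\<in>conf R (l - k). \<Sum>\<omega>\<in>conf {y, z} k. G (\<zeta> + \<omega>)) + 4 * X u"
        unfolding X_def by (simp add: sum.distrib sum_distrib_left)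
      also have "(\<Sum>k\<le>l. \<Sum>\<zeta>\<in>conf R (l - k). \<Sum>\<omega>\<in>conf {y, z} k. G (\<zeta> + \<omega>)) = (\<Sum>\<tau>\<in>conf S l. G \<tau>)"
        unfolding S using finR disj by (subst sum_conf_Un) auto
      also have "\<dots> \<le> (real M)\<^sup>2 * (edge S r f y u + edge S r f z u)"
      proof -
        have u': "u \<in> S" using u by (simp add: R_def)
        have e: "l + M - 1 = r" using l by (simp add: m_def)
        show ?thesis unfolding G_def sum.distrib distrib_left
          using block_move_le_edge[OF fin y u', of f M l] block_move_le_edge[OF fin z u', of f M l] unfolding e by simp
      qed
      finally show ?thesis by simp
    qed
    have "n * (\<Sum>k=M..l. w (k + M)) = (\<Sum>u\<in>R. \<Sum>k=M..l. w (k + M))" by (simp add: n_def)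
    also have "\<dots> \<le> (\<Sum>u\<in>R. 2 * ((real M)\<^sup>2 * (edge S r f y u + edge S r f z u)) + 4 * X u)"
      by (intro sum_mono each)
    also have "\<dots> = 2 * (real M)\<^sup>2 * B + 4 * (\<Sum>u\<in>R. X u)"
      by (simp add: sum.distrib sum_distrib_left B_def mult.assoc distrib_left)
    also have "4 * (\<Sum>u\<in>R. X u) \<le> n / 2 * V"
    proof -
      have "real M * (\<Sum>u\<in>R. X u) = (\<Sum>k\<le>l. real M * (\<Sum>u\<in>R. \<Sum>\<zeta>\<in>conf R (l - k). W k (\<zeta> + single u M)))"
        unfolding X_def sum_distrib_left[symmetric] by (subst sum.swap) (rule refl)
      also have "\<dots> \<le> (\<Sum>k\<le>l. real m * w k)"
      proof (rule sum_mono)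
        fix k assume k: "k \<in> {..l}"
        have e: "l - k + M = m - k" using l k by simp
        have "real M * (\<Sum>u\<in>R. \<Sum>\<zeta>\<in>conf R (l - k). W k (\<zeta> + single u M)) \<le> real (l - k + M) * (\<Sum>\<zeta>\<in>conf R (l - k + M). W k \<zeta>)"
          by (rule sum_conf_dumped[OF finR W0 M])
        also have "\<dots> \<le> real m * w k" unfolding e w_def[symmetric] by (intro mult_right_mono w0) simp
        finally show "real M * (\<Sum>u\<in>R. \<Sum>\<zeta>\<in>conf R (l - k). W k (\<zeta> + single u M)) \<le> real m * w k" .
      qed
      also have "\<dots> \<le> (\<Sum>k\<le>m. real m * w k)" using l w0 by (intro sum_mono2) auto
      also have "\<dots> = real m * V" by (simp add: V_def sum_distrib_left)
      finally have 1: "real M * (\<Sum>u\<in>R. X u) \<le> real m * V" .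
      \<comment> \<open>The Markov bound gives \<open>m / M * V\<close>; the constant 8 in
        \<open>dense\<close> makes four times this at most \<open>n / 2 * V\<close>.\<close>
      have "8 * real m \<le> real M * n" using dense unfolding n_def R_def m_def by (metis of_nat_le_iff of_nat_mult of_nat_numeral)
      then have "8 * real m * V \<le> real M * n * V" by (rule mult_right_mono[OF _ V0])
      then have "real M * (8 * (\<Sum>u\<in>R. X u)) \<le> real M * (n * V)" using 1 by (simp add: mult.assoc)
      then show ?thesis using M by simp
    qed
    finally show ?thesis unfolding shift by simp
  qed
  have "n * V \<le> n * (4 * (real M)\<^sup>2 * edge S r f y z) + (2 * (real M)\<^sup>2 * B + n / 2 * V)"
  proof -
    have "n * (\<Sum>k\<le>m. if k < 2 * M then w k else 0) \<le> n * (4 * (real M)\<^sup>2 * edge S r f y z)"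
      using n by (intro mult_left_mono[OF low]) simp
    moreover have "n * V = n * (\<Sum>k\<le>m. if k < 2 * M then w k else 0) + n * (\<Sum>k\<le>m. if 2 * M \<le> k then w k else 0)"
      by (subst split) (simp only: distrib_left)
    ultimately show ?thesis using high by linarith
  qed
  then have "V \<le> 8 * (real M)\<^sup>2 * edge S r f y z + 4 * (real M)\<^sup>2 / n * B"
    using n by (simp add: field_simps)
  then show ?thesis unfolding V by (simp add: n_def B_def R_def)
qed

text \<open>Each of the two summands involves only two of three distinct sites, so the third
  contributes a factor \<open>card S - 2\<close>.\<close>

lemma sum_pairs_averaged:
  fixes c :: "'a \<Rightarrow> 'a \<Rightarrow> real"
  assumes fin: "finite S" and S: "card S \<ge> 3" and sym: "\<And>x y. c x y = c y x"
  shows "(\<Sum>y\<in>S. \<Sum>z\<in>S - {y}. \<Sum>u\<in>S - {y, z}. c y u + c z u) = 2 * (real (card S) - 2) * (\<Sum>y\<in>S. \<Sum>z\<in>S - {y}. c y z)"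
proof -
  let ?P = "\<Sum>y\<in>S. \<Sum>z\<in>S - {y}. c y z"
  have 1: "(\<Sum>z\<in>S. \<Sum>y\<in>S - {z}. \<Sum>u\<in>S - {z} - {y}. c y u) = (real (card S) - 2) * ?P"
    by (rule sum_distinct_triples[OF fin])
  have "(\<Sum>y\<in>S. \<Sum>z\<in>S - {y}. \<Sum>u\<in>S - {y, z}. c y u) = (\<Sum>z\<in>S. \<Sum>y\<in>S - {z}. \<Sum>u\<in>S - {z} - {y}. c y u)"
  proof -
    have "(\<Sum>y\<in>S. \<Sum>z\<in>S - {y}. \<Sum>u\<in>S - {y, z}. c y u) = (\<Sum>y\<in>S. \<Sum>z\<in>S. if z \<noteq> y then \<Sum>u\<in>S - {y, z}. c y u else 0)"
      by (simp add: sum_remove_if[OF fin])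
    also have "\<dots> = (\<Sum>z\<in>S. \<Sum>y\<in>S. if y \<noteq> z then \<Sum>u\<in>S - {z} - {y}. c y u else 0)"
      by (subst sum.swap) (intro sum.cong refl if_cong; auto)
    also have "\<dots> = (\<Sum>z\<in>S. \<Sum>y\<in>S - {z}. \<Sum>u\<in>S - {z} - {y}. c y u)"
      by (simp add: sum_remove_if[OF fin])
    finally show ?thesis .
  qed
  moreover have "(\<Sum>y\<in>S. \<Sum>z\<in>S - {y}. \<Sum>u\<in>S - {y, z}. c z u) = (\<Sum>y\<in>S. \<Sum>z\<in>S - {y}. \<Sum>u\<in>S - {y} - {z}. c z u)"
    by (intro sum.cong refl) auto
  ultimately show ?thesis using 1 by (simp add: sum.distrib)
qed

text \<open>Averaged over third sites, the dump terms contribute \<open>8 * M\<^sup>2\<close> per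
  pair, as much as the direct ones. The total 16 times \<open>3 / (2 * (n + 1))\<close> is at most
  \<open>24 / n\<close>.\<close>

theorem variance_le_edges:
  assumes fin: "finite S" and S: "card S \<ge> 3" and M: "M > 0" and dense: "8 * Suc r \<le> M * (card S - 2)"
  shows "var_sum (conf S (Suc r)) f \<le> 24 * (real M)\<^sup>2 / real (card S) * (\<Sum>y\<in>S. \<Sum>z\<in>S. edge S r f y z)"
proof -
  define n where "n = real (card S)"
  have n: "n \<ge> 3" using S by (simp add: n_def)
  define P where "P = (\<Sum>y\<in>S. \<Sum>z\<in>S - {y}. edge S r f y z)"
  have P0: "P \<ge> 0" by (simp add: P_def sum_nonneg edge_nonneg)
  have e0: "edge S r f x x = 0" for x by (simp add: edge_def)
  have P: "(\<Sum>y\<in>S. \<Sum>z\<in>S. edge S r f y z) = P"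
    unfolding P_def
  proof (rule sum.cong[OF refl])
    fix y assume "y \<in> S"
    then show "(\<Sum>z\<in>S. edge S r f y z) = (\<Sum>z\<in>S - {y}. edge S r f y z)"
      using sum.remove[OF fin, of y "edge S r f y"] e0 by simp
  qed
  have cR: "card (S - {y, z}) = card S - 2" if "y \<in> S" "z \<in> S - {y}" for y z
    using that fin by (subst card_Diff_subset) auto
  have cR': "real (card S - 2) = n - 2" using S by (simp add: n_def)
  have pv: "pair_var S y z (Suc r) f \<le> 8 * (real M)\<^sup>2 * edge S r f y z
      + 4 * (real M)\<^sup>2 / (n - 2) * (\<Sum>u\<in>S - {y, z}. edge S r f y u + edge S r f z u)"
    if "y \<in> S" "z \<in> S - {y}" for y z
    using pair_var_le_edges[OF fin, of y z M r f] that M S dense cR[OF that] unfolding cR'[symmetric] by auto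
  define Q where "Q y z = (\<Sum>u\<in>S - {y, z}. edge S r f y u + edge S r f z u)" for y z
  have Q: "(\<Sum>y\<in>S. \<Sum>z\<in>S - {y}. Q y z) = 2 * (n - 2) * P"
    unfolding Q_def P_def n_def by (rule sum_pairs_averaged[OF fin S edge_commute])
  have "(\<Sum>y\<in>S. \<Sum>z\<in>S - {y}. pair_var S y z (Suc r) f)
    \<le> (\<Sum>y\<in>S. \<Sum>z\<in>S - {y}. 8 * (real M)\<^sup>2 * edge S r f y z + 4 * (real M)\<^sup>2 / (n - 2) * Q y z)"
    unfolding Q_def by (intro sum_mono pv)
  also have "\<dots> = 8 * (real M)\<^sup>2 * P + 4 * (real M)\<^sup>2 / (n - 2) * (2 * (n - 2) * P)"
    unfolding Q[symmetric] by (simp only: sum.distrib sum_distrib_left P_def)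
  also have "\<dots> = 16 * (real M)\<^sup>2 * P" using n by (simp add: field_simps)
  finally have *: "(\<Sum>y\<in>S. \<Sum>z\<in>S - {y}. pair_var S y z (Suc r) f) \<le> 16 * (real M)\<^sup>2 * P" .
  obtain b where b: "card S = b + 2" using S that[of "card S - 2"] by simp
  have "var_sum (conf S (Suc r)) f \<le> 3 / (2 * real (b + 3)) * (\<Sum>y\<in>S. \<Sum>z\<in>S - {y}. pair_var S y z (Suc r) f)"
    by (rule variance_le_pair_variances[OF fin b])
  also have "\<dots> \<le> 3 / (2 * real (b + 3)) * (16 * (real M)\<^sup>2 * P)"
    by (rule mult_left_mono[OF *]) simp
  also have "\<dots> = 24 * (real M)\<^sup>2 * P / real (b + 3)" by (simp add: field_simps)
  also have "\<dots> \<le> 24 * (real M)\<^sup>2 * P / n"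
    using P0 b n by (intro divide_left_mono) (auto simp: n_def)
  finally show ?thesis unfolding P n_def by simp
qed

section \<open>Path comparison on the torus\<close>

lemma finite_torus [simp]: "finite (torus d L)"
proof (rule finite_subset)
  show "torus d L \<subseteq> {f. \<forall>x. (x \<in> {..<d} \<longrightarrow> f x \<in> {..<L}) \<and> (x \<notin> {..<d} \<longrightarrow> f x = 0)}"
    by (auto simp: torus_def)
qed (intro finite_set_of_finite_funs; simp)

lemma card_torus: "card (torus d L) = L ^ d"
proof (induction d)
  case 0
  have "torus 0 L = {\<lambda>_. 0}" by (auto simp: torus_def)
  then show ?case by simp
next
  case (Suc d)
  have "bij_betw (\<lambda>x. (x(d := 0), x d)) (torus (Suc d) L) (torus d L \<times> {..<L})"
    by (rule bij_betw_byWitness[where f'="\<lambda>(x, t). x(d := t)"]) (auto simp: torus_def less_Suc_eq fun_eq_iff)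
  then show ?case using Suc by (simp add: bij_betw_same_card card_cartesian_product)
qed

text \<open>Walk from the smaller to the larger endpoint without wrapping around, and bound the
  energy of this segment by that of the whole cycle.\<close>

lemma line_difference_square:
  fixes \<psi> :: "nat \<Rightarrow> real"
  assumes "p < L" "q < L"
  shows "(\<psi> q - \<psi> p)\<^sup>2 \<le> real L * (\<Sum>s<L. (\<psi> (Suc s mod L) - \<psi> s)\<^sup>2)"
proof -
  have *: "(\<psi> q - \<psi> p)\<^sup>2 \<le> real L * (\<Sum>s<L. (\<psi> (Suc s mod L) - \<psi> s)\<^sup>2)" if "p \<le> q" "q < L" for p q
  proof -
    have "(\<psi> q - \<psi> p)\<^sup>2 \<le> real (q - p) * (\<Sum>i<q - p. (\<psi> (Suc i + p) - \<psi> (i + p))\<^sup>2)"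
      using telescope_square[of "\<lambda>i. \<psi> (i + p)" "q - p"] that by simp
    also have "(\<Sum>i<q - p. (\<psi> (Suc i + p) - \<psi> (i + p))\<^sup>2) = (\<Sum>i<q - p. (\<psi> (Suc (i + p) mod L) - \<psi> (i + p))\<^sup>2)"
      using that by (intro sum.cong) auto
    also have "real (q - p) * \<dots> \<le> real L * (\<Sum>s<L. (\<psi> (Suc s mod L) - \<psi> s)\<^sup>2)"
      using that by (intro mult_mono sum_le_sum_inj_image[where h="\<lambda>i. i + p"] sum_nonneg) auto
    finally show ?thesis .
  qed
  show ?thesis using *[of p q] *[of q p] assms by (cases "p \<le> q") (auto simp: power2_commute)
qed

text \<open>Change the coordinates from \<open>x\<close> to \<open>y\<close> one at a time; for every stage \<open>k\<close> the pair of
  the current point and its complement is a bijective image of \<open>(x, y)\<close>.\<close>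

lemma torus_poincare:
  fixes F :: "(nat \<Rightarrow> nat) \<Rightarrow> real"
  shows "(\<Sum>x\<in>torus d L. \<Sum>y\<in>torus d L. (F x - F y)\<^sup>2)
    \<le> real d * (real L)\<^sup>2 * real L ^ d * (\<Sum>i<d. \<Sum>x\<in>torus d L. (F (nbr L x i True) - F x)\<^sup>2)"
proof -
  let ?T = "torus d L"
  define h where "h k x y = (\<lambda>i. if i < k then y i else x i)" for k :: nat and x y :: "nat \<Rightarrow> nat"
  define e where "e k x = (F (nbr L x k True) - F x)\<^sup>2" for k x
  have stage: "(\<Sum>x\<in>?T. \<Sum>y\<in>?T. (F (h (Suc k) x y) - F (h k x y))\<^sup>2) \<le> (real L)\<^sup>2 * real L ^ d * (\<Sum>x\<in>?T. e k x)"
    if k: "k < d" for k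
  proof -
    have "(\<Sum>x\<in>?T. \<Sum>y\<in>?T. (F (h (Suc k) x y) - F (h k x y))\<^sup>2)
      = (\<Sum>(x,y)\<in>?T \<times> ?T. (F (h (Suc k) x y) - F (h k x y))\<^sup>2)"
      by (simp add: sum.cartesian_product)
    also have "\<dots> = (\<Sum>(a,g)\<in>?T \<times> ?T. (F (a(k := g k)) - F a)\<^sup>2)"
    \<comment> \<open>Exchanging the first \<open>k\<close> coordinates is an involution on pairs.
      The second component still holds coordinate \<open>k\<close> of \<open>y\<close>, so the stage
      changes \<open>a\<close> into \<open>a(k := g k)\<close>.\<close>
    proof (rule sum.reindex_bij_witness[where i="\<lambda>(x,y). (h k x y, h k y x)" and j="\<lambda>(x,y). (h k x y, h k y x)"])
      fix p assume "p \<in> ?T \<times> ?T"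
      then obtain x y where p: "p = (x, y)" "x \<in> ?T" "y \<in> ?T" by auto
      have mem: "h k x y \<in> ?T" "h k y x \<in> ?T" using p by (auto simp: torus_def h_def)
      show "(case p of (x, y) \<Rightarrow> (h k x y, h k y x)) \<in> ?T \<times> ?T" using p mem by simp
      show "(case (case p of (x, y) \<Rightarrow> (h k x y, h k y x)) of (x, y) \<Rightarrow> (h k x y, h k y x)) = p"
        using p by (auto simp: h_def fun_eq_iff)
      then show "(case (case p of (x, y) \<Rightarrow> (h k x y, h k y x)) of (x, y) \<Rightarrow> (h k x y, h k y x)) = p" .
      show "(case p of (x, y) \<Rightarrow> (h k x y, h k y x)) \<in> ?T \<times> ?T" using p mem by simp
      have "h (Suc k) x y = (h k x y)(k := h k y x k)" by (auto simp: h_def fun_eq_iff)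
      then show "(case (case p of (x, y) \<Rightarrow> (h k x y, h k y x)) of (a, g) \<Rightarrow> (F (a(k := g k)) - F a)\<^sup>2)
        = (case p of (x, y) \<Rightarrow> (F (h (Suc k) x y) - F (h k x y))\<^sup>2)" using p by simp
    qed
    also have "\<dots> = (\<Sum>a\<in>?T. \<Sum>g\<in>?T. (F (a(k := g k)) - F a)\<^sup>2)" by (simp add: sum.cartesian_product)
    also have "\<dots> \<le> (\<Sum>a\<in>?T. \<Sum>g\<in>?T. real L * (\<Sum>s<L. e k (a(k := s))))"
    proof (intro sum_mono)
      fix a g assume "a \<in> ?T" "g \<in> ?T"
      then have "a k < L" "g k < L" using k by (auto simp: torus_def)
      from line_difference_square[OF this, of "\<lambda>t. F (a(k := t))"]
      show "(F (a(k := g k)) - F a)\<^sup>2 \<le> real L * (\<Sum>s<L. e k (a(k := s)))"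
        by (simp add: e_def nbr_def)
    qed
    also have "\<dots> = real L * real L ^ d * (\<Sum>a\<in>?T. \<Sum>s<L. e k (a(k := s)))"
      by (simp add: card_torus sum_distrib_left mult_ac)
    also have "(\<Sum>a\<in>?T. \<Sum>s<L. e k (a(k := s))) = (\<Sum>(a,s)\<in>?T \<times> {..<L}. e k (a(k := s)))"
      by (simp add: sum.cartesian_product)
    \<comment> \<open>Swapping \<open>s\<close> with coordinate \<open>k\<close> of \<open>a\<close>
      is an involution too; afterwards \<open>s\<close> is free and gives the second factor
      \<open>L\<close>.\<close>
    also have "\<dots> = (\<Sum>(a,s)\<in>?T \<times> {..<L}. e k a)"
      by (rule sum.reindex_bij_witness[where i="\<lambda>(a,s). (a(k := s), a k)" and j="\<lambda>(a,s). (a(k := s), a k)"])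
        (use k in \<open>auto simp: torus_def\<close>)
    also have "\<dots> = real L * (\<Sum>a\<in>?T. e k a)"
      by (simp add: sum.cartesian_product[symmetric] sum_distrib_left)
    finally show ?thesis by (simp add: power2_eq_square mult_ac)
  qed
  have "(\<Sum>x\<in>?T. \<Sum>y\<in>?T. (F x - F y)\<^sup>2)
    \<le> (\<Sum>x\<in>?T. \<Sum>y\<in>?T. real d * (\<Sum>k<d. (F (h (Suc k) x y) - F (h k x y))\<^sup>2))"
  proof (intro sum_mono)
    fix x y assume "x \<in> ?T" "y \<in> ?T"
    then have "h 0 x y = x" "h d x y = y" by (auto simp: h_def torus_def fun_eq_iff)
    then show "(F x - F y)\<^sup>2 \<le> real d * (\<Sum>k<d. (F (h (Suc k) x y) - F (h k x y))\<^sup>2)"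
      using telescope_square[of "\<lambda>k. F (h k x y)" d] by (simp add: power2_commute)
  qed
  also have "\<dots> = real d * (\<Sum>k<d. \<Sum>x\<in>?T. \<Sum>y\<in>?T. (F (h (Suc k) x y) - F (h k x y))\<^sup>2)"
    unfolding sum_distrib_left[symmetric]
    by (rule arg_cong[where f="\<lambda>t. real d * t"], subst (2) sum.swap, rule sum.cong[OF refl], rule sum.swap)
  also have "\<dots> \<le> real d * (\<Sum>k<d. (real L)\<^sup>2 * real L ^ d * (\<Sum>x\<in>?T. e k x))"
    by (intro mult_left_mono sum_mono stage) auto
  finally show ?thesis by (simp add: e_def sum_distrib_left mult_ac)
qed


section \<open>From edge energies to the Dirichlet form and the spectral gap\<close>

lemma zrp_configs_eq: "zrp_configs d L r = conf (torus d L) r"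
  by (simp add: zrp_configs_def conf_def)

lemma zrp_var_eq: "zrp_var d L r f = var_sum (conf (torus d L) r) f / real (card (conf (torus d L) r))"
  by (simp add: zrp_var_def zrp_mean_def zrp_pi_def zrp_configs_eq var_sum_def sum_divide_distrib)

text \<open>Keep only the forward jumps; adding a particle at \<open>x\<close> maps backgrounds
  injectively to configurations with \<open>x\<close> occupied. The constant collects 2 from the
  prefactor, \<open>2 * d\<close> from the jump kernel and the cardinality from the uniform
  measure.\<close>

lemma zrp_dirichlet_ge:
  assumes L: "L \<ge> 2"
  shows "(\<Sum>i<d. \<Sum>x\<in>torus d L. edge (torus d L) r f (nbr L x i True) x)
    \<le> 4 * real d * real (card (conf (torus d L) (Suc r))) * zrp_dirichlet d L (Suc r) f"
proof (cases "d = 0")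
  case False
  let ?T = "torus d L" let ?C = "conf (torus d L) (Suc r)"
  define N where "N = real (card ?C)"
  have N: "N > 0" using mc_pos[of "L ^ d" "Suc r"] L by (simp add: N_def card_conf card_torus)
  define t where "t \<eta> x i b = (f (move \<eta> x (nbr L x i b)) - f \<eta>)\<^sup>2" for \<eta> x i b
  define q where "q \<eta> x = (if 1 \<le> \<eta> x then \<Sum>i<d. \<Sum>b\<in>UNIV. 1 / (2 * real d) * t \<eta> x i b else 0)" for \<eta> x
  define g where "g x i \<eta> = (if 1 \<le> \<eta> x then (f (move \<eta> x (nbr L x i True)) - f \<eta>)\<^sup>2 else 0)" for x i \<eta>
  have e: "edge ?T r f (nbr L x i True) x \<le> (\<Sum>\<eta>\<in>?C. g x i \<eta>)" if x: "x \<in> ?T" and i: "i < d" for x i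
  proof -
    \<comment> \<open>A neighbour distinct from \<open>x\<close> is what makes \<open>move\<close>
      carry \<open>\<xi> + single x 1\<close> to the background plus one particle at the
      neighbour.\<close>
    have "(x i + 1) mod L \<noteq> x i" using x i L
      by (cases "x i + 1 = L") (auto simp: torus_def mod_less)
    then have "nbr L x i True i \<noteq> x i" by (simp add: nbr_def)
    then have ne: "nbr L x i True \<noteq> x" by auto
    have mv: "move (\<xi> + single x 1) x (nbr L x i True) = \<xi> + single (nbr L x i True) 1" for \<xi>
      using ne by (intro ext) (simp add: move_def)
    have "edge ?T r f (nbr L x i True) x = (\<Sum>\<xi>\<in>conf ?T r. g x i (\<xi> + single x 1))"
      unfolding edge_def g_def mv by simp
    also have "\<dots> \<le> (\<Sum>\<eta>\<in>?C. g x i \<eta>)"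
      using conf_add_single[OF finite_torus x, of _ r 1]
      by (intro sum_le_sum_inj_image[where h="\<lambda>\<xi>. \<xi> + single x 1"]) (auto simp: inj_on_def g_def)
    finally show ?thesis .
  qed
  have "(\<Sum>i<d. \<Sum>x\<in>?T. edge ?T r f (nbr L x i True) x) \<le> (\<Sum>i<d. \<Sum>x\<in>?T. \<Sum>\<eta>\<in>?C. g x i \<eta>)"
    by (intro sum_mono e) auto
  also have "\<dots> = (\<Sum>\<eta>\<in>?C. \<Sum>x\<in>?T. \<Sum>i<d. g x i \<eta>)"
  proof -
    have "(\<Sum>i<d. \<Sum>x\<in>?T. \<Sum>\<eta>\<in>?C. g x i \<eta>) = (\<Sum>x\<in>?T. \<Sum>i<d. \<Sum>\<eta>\<in>?C. g x i \<eta>)" by (rule sum.swap)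
    also have "\<dots> = (\<Sum>x\<in>?T. \<Sum>\<eta>\<in>?C. \<Sum>i<d. g x i \<eta>)" by (rule sum.cong[OF refl], rule sum.swap)
    also have "\<dots> = (\<Sum>\<eta>\<in>?C. \<Sum>x\<in>?T. \<Sum>i<d. g x i \<eta>)" by (rule sum.swap)
    finally show ?thesis .
  qed
  also have "\<dots> \<le> (\<Sum>\<eta>\<in>?C. \<Sum>x\<in>?T. 2 * real d * q \<eta> x)"
  proof (intro sum_mono)
    fix \<eta> x
    have t: "t \<eta> x i True \<le> 2 * real d * (\<Sum>b\<in>UNIV. 1 / (2 * real d) * t \<eta> x i b)" for i
      using False by (simp add: UNIV_bool distrib_left t_def)
    show "(\<Sum>i<d. g x i \<eta>) \<le> 2 * real d * q \<eta> x"
      using sum_mono[of "{..<d}", OF t] by (simp add: g_def q_def t_def sum_distrib_left)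
  qed
  also have "\<dots> = 4 * real d * N * ((1 / 2) * (\<Sum>\<eta>\<in>?C. 1 / N * (\<Sum>x\<in>?T. q \<eta> x)))"
    using N by (simp only: sum_distrib_left[symmetric]) simp
  also have "(1 / 2) * (\<Sum>\<eta>\<in>?C. 1 / N * (\<Sum>x\<in>?T. q \<eta> x)) = zrp_dirichlet d L (Suc r) f"
    by (simp only: zrp_dirichlet_def zrp_pi_def zrp_configs_eq N_def q_def t_def)
  finally show ?thesis unfolding N_def .
qed simp

text \<open>For each fixed background \<open>\<xi>\<close>, \<open>torus_poincare\<close> applies to
  the position of the remaining particle. Its factor \<open>n = L ^ d\<close> cancels the
  \<open>1 / n\<close> of the complete graph estimate, and \<open>24 * 4 = 96\<close>.\<close>

lemma zrp_var_le_dirichlet: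
  assumes d: "d \<ge> 1" and L: "L \<ge> 3" and M: "M > 0" and dense: "8 * Suc r \<le> M * (L ^ d - 2)"
  shows "zrp_var d L (Suc r) f \<le> 96 * (real M)\<^sup>2 * (real d)\<^sup>2 * (real L)\<^sup>2 * zrp_dirichlet d L (Suc r) f"
proof -
  let ?T = "torus d L"
  define n where "n = real L ^ d"
  define N where "N = real (card (conf ?T (Suc r)))"
  define D where "D = zrp_dirichlet d L (Suc r) f"
  have N: "N > 0" using mc_pos[of "L ^ d" "Suc r"] L by (simp add: N_def card_conf card_torus)
  have "L ^ 1 \<le> L ^ d" using d L by (intro power_increasing) auto
  then have L3: "3 \<le> L ^ d" using L by simp
  then have n: "n > 0" using L by (simp add: n_def)
  have "(\<Sum>y\<in>?T. \<Sum>z\<in>?T. edge ?T r f y z)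
    = (\<Sum>\<xi>\<in>conf ?T r. \<Sum>y\<in>?T. \<Sum>z\<in>?T. (f (\<xi> + single y 1) - f (\<xi> + single z 1))\<^sup>2)"
  proof -
    have "(\<Sum>y\<in>?T. \<Sum>z\<in>?T. edge ?T r f y z) = (\<Sum>y\<in>?T. \<Sum>\<xi>\<in>conf ?T r. \<Sum>z\<in>?T. (f (\<xi> + single y 1) - f (\<xi> + single z 1))\<^sup>2)"
      unfolding edge_def by (rule sum.cong[OF refl], rule sum.swap)
    also have "\<dots> = (\<Sum>\<xi>\<in>conf ?T r. \<Sum>y\<in>?T. \<Sum>z\<in>?T. (f (\<xi> + single y 1) - f (\<xi> + single z 1))\<^sup>2)"
      by (rule sum.swap)
    finally show ?thesis .
  qed
  also have "\<dots> \<le> (\<Sum>\<xi>\<in>conf ?T r. real d * (real L)\<^sup>2 * n *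
      (\<Sum>i<d. \<Sum>x\<in>?T. (f (\<xi> + single (nbr L x i True) 1) - f (\<xi> + single x 1))\<^sup>2))"
    unfolding n_def by (intro sum_mono torus_poincare)
  also have "\<dots> = real d * (real L)\<^sup>2 * n * (\<Sum>i<d. \<Sum>x\<in>?T. edge ?T r f (nbr L x i True) x)"
  proof -
    have "(\<Sum>i<d. \<Sum>x\<in>?T. edge ?T r f (nbr L x i True) x)
      = (\<Sum>i<d. \<Sum>\<xi>\<in>conf ?T r. \<Sum>x\<in>?T. (f (\<xi> + single (nbr L x i True) 1) - f (\<xi> + single x 1))\<^sup>2)"
      unfolding edge_def by (rule sum.cong[OF refl], rule sum.swap)
    also have "\<dots> = (\<Sum>\<xi>\<in>conf ?T r. \<Sum>i<d. \<Sum>x\<in>?T. (f (\<xi> + single (nbr L x i True) 1) - f (\<xi> + single x 1))\<^sup>2)"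
      by (rule sum.swap)
    finally show ?thesis by (simp only: sum_distrib_left)
  qed
  also have "\<dots> \<le> real d * (real L)\<^sup>2 * n * (4 * real d * N * D)"
    unfolding N_def D_def using n L by (intro mult_left_mono zrp_dirichlet_ge) auto
  finally have *: "(\<Sum>y\<in>?T. \<Sum>z\<in>?T. edge ?T r f y z) \<le> real d * (real L)\<^sup>2 * n * (4 * real d * N * D)" .
  have "var_sum (conf ?T (Suc r)) f \<le> 24 * (real M)\<^sup>2 / n * (\<Sum>y\<in>?T. \<Sum>z\<in>?T. edge ?T r f y z)"
    using variance_le_edges[OF finite_torus _ M, of d L r f] L3 dense by (simp add: card_torus n_def)
  also have "\<dots> \<le> 24 * (real M)\<^sup>2 / n * (real d * (real L)\<^sup>2 * n * (4 * real d * N * D))"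
    using n by (intro mult_left_mono[OF *]) auto
  also have "\<dots> = N * (96 * (real M)\<^sup>2 * (real d)\<^sup>2 * (real L)\<^sup>2 * D)"
    using n by (simp add: field_simps power2_eq_square)
  finally show ?thesis unfolding zrp_var_eq N_def[symmetric] D_def[symmetric] using N by (simp add: field_simps)
qed

text \<open>Ensures that the infimum defining the gap runs over a nonempty set. The occupation
  number of \<open>a\<close> separates all particles at \<open>a\<close> from all particles at
  \<open>b\<close>.\<close>

lemma zrp_var_not_always_zero:
  assumes d: "d \<ge> 1" and L: "L \<ge> 2" and r: "r \<ge> 1"
  shows "\<exists>f. zrp_var d L r f \<noteq> 0"
proof -
  let ?T = "torus d L" let ?C = "conf (torus d L) r"
  define a b where "a = (\<lambda>i::nat. 0::nat)" and "b = a(0 := 1)"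
  have a: "a \<in> ?T" using L by (simp add: torus_def a_def)
  have b: "b \<in> ?T" using d L by (simp add: torus_def a_def b_def)
  have "a 0 \<noteq> b 0" by (simp add: a_def b_def)
  then have ab: "a \<noteq> b" by (rule contrapos_nn) (simp only:)
  have mem: "single x r \<in> ?C" if "x \<in> ?T" for x using that by (auto simp: conf_def single_def)
  define f where "f \<eta> = real (\<eta> a)" for \<eta> :: "(nat \<Rightarrow> nat) \<Rightarrow> nat"
  define c where "c = sum f ?C / real (card ?C)"
  have "var_sum ?C f \<noteq> 0"
  proof
    assume "var_sum ?C f = 0"
    then have "(\<Sum>\<eta>\<in>?C. (f \<eta> - c)\<^sup>2) = 0" by (simp only: var_sum_def c_def)
    then have "\<forall>\<eta>\<in>?C. f \<eta> = c" by (subst (asm) sum_nonneg_eq_0_iff) auto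
    then have "f (single a r) = f (single b r)" using mem[OF a] mem[OF b] by metis
    moreover have "f (single a r) = real r" "f (single b r) = 0" using ab by (simp_all add: f_def)
    ultimately show False using r by simp
  qed
  moreover have "card ?C \<noteq> 0" using mem[OF a] by auto
  ultimately have "zrp_var d L r f \<noteq> 0" by (simp add: zrp_var_eq)
  then show ?thesis by (intro exI[of _ f])
qed

theorem mainTheorem1:
  "\<exists>C::real. C > 0 \<and>
     (\<forall>d L r :: nat. 1 \<le> d \<longrightarrow> 3 \<le> L \<longrightarrow> 1 \<le> r \<longrightarrow>
        (let \<rho> = real r / real L ^ d in
          zrp_relax_time d L r \<le> C * real d ^ 2 * (\<rho> + 1) ^ 2 * real L ^ 2))"
proof (intro exI[of _ 55296] conjI allI impI)
  fix d L r :: nat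
  assume d: "1 \<le> d" and L: "3 \<le> L" and r: "1 \<le> r"
  define \<rho> where "\<rho> = real r / real L ^ d"
  \<comment> \<open>Since \<open>L ^ d \<ge> 3\<close> gives
    \<open>L ^ d - 2 \<ge> L ^ d / 3\<close>, the choice \<open>M \<ge> 24 * \<rho>\<close>
    guarantees \<open>8 * r \<le> M * (L ^ d - 2)\<close>.\<close>
  define M where "M = nat \<lceil>24 * \<rho>\<rceil>"
  \<comment> \<open>Here \<open>55296 = 96 * 24\<^sup>2\<close>, because
    \<open>M \<le> 24 * (\<rho> + 1)\<close>.\<close>
  define A where "A = 55296 * real d ^ 2 * (\<rho> + 1) ^ 2 * real L ^ 2"
  have "L ^ 1 \<le> L ^ d" using d L by (intro power_increasing) auto
  then have L3: "3 \<le> L ^ d" using L by simp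
  have \<rho>: "\<rho> > 0" using L r by (simp add: \<rho>_def)
  have M: "M > 0" "real M \<le> 24 * \<rho> + 1" "24 * \<rho> \<le> real M" using \<rho> unfolding M_def by linarith+
  have dense: "8 * r \<le> M * (L ^ d - 2)"
  proof -
    have n: "real (L ^ d - 2) \<ge> real L ^ d / 3" using L3 by (simp add: of_nat_diff flip: of_nat_power)
    have "real (8 * r) = 24 * \<rho> * (real L ^ d / 3)" using L by (simp add: \<rho>_def)
    also have "\<dots> \<le> real M * real (L ^ d - 2)" using M n \<rho> by (intro mult_mono) auto
    finally show ?thesis by (metis of_nat_le_iff of_nat_mult)
  qed
  have A: "A > 0" using d L \<rho> by (simp add: A_def)
  have bound: "zrp_var d L r f \<le> A * zrp_dirichlet d L r f" for f
  proof -
    obtain r' where r': "r = Suc r'" using r by (cases r) auto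
    have D: "zrp_dirichlet d L r f \<ge> 0"
      unfolding zrp_dirichlet_def zrp_pi_def by (intro mult_nonneg_nonneg sum_nonneg) (auto intro!: sum_nonneg)
    have "(real M)\<^sup>2 \<le> (24 * (\<rho> + 1))\<^sup>2" using M by (intro power_mono) auto
    also have "(24 * (\<rho> + 1))\<^sup>2 = 576 * (\<rho> + 1)\<^sup>2" by (subst power_mult_distrib) simp
    finally have "(real M)\<^sup>2 \<le> 576 * (\<rho> + 1)\<^sup>2" .
    then have "(real M)\<^sup>2 * (96 * (real d)\<^sup>2 * (real L)\<^sup>2 * zrp_dirichlet d L r f)
      \<le> 576 * (\<rho> + 1)\<^sup>2 * (96 * (real d)\<^sup>2 * (real L)\<^sup>2 * zrp_dirichlet d L r f)"
      using D by (intro mult_right_mono) auto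
    moreover have "zrp_var d L r f \<le> 96 * (real M)\<^sup>2 * (real d)\<^sup>2 * (real L)\<^sup>2 * zrp_dirichlet d L r f"
      using zrp_var_le_dirichlet[OF d L M(1), of r' f] dense by (simp add: r')
    ultimately show ?thesis by (simp add: A_def mult_ac)
  qed
  have "1 / A \<le> zrp_gap d L r"
    unfolding zrp_gap_def
  proof (rule cInf_greatest)
    show "{zrp_dirichlet d L r f / zrp_var d L r f |f. zrp_var d L r f \<noteq> 0} \<noteq> {}"
      using zrp_var_not_always_zero[OF d _ r] L by auto
  next
    fix q assume "q \<in> {zrp_dirichlet d L r f / zrp_var d L r f |f. zrp_var d L r f \<noteq> 0}"
    then obtain f where q: "q = zrp_dirichlet d L r f / zrp_var d L r f" and "zrp_var d L r f \<noteq> 0" by auto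
    then have "zrp_var d L r f > 0"
      using var_sum_nonneg[of "conf (torus d L) r" f] by (simp add: zrp_var_eq order_less_le)
    then show "1 / A \<le> q" using bound[of f] A by (simp add: q field_simps)
  qed
  \<comment> \<open>As \<open>1 / A\<close> is positive, so is the gap, and reciprocals reverse the
    inequality.\<close>
  then have "zrp_relax_time d L r \<le> A"
    using A le_imp_inverse_le[of "1 / A" "zrp_gap d L r"] by (simp add: zrp_relax_time_def inverse_eq_divide)
  then show "let \<rho> = real r / real L ^ d in zrp_relax_time d L r \<le> 55296 * real d ^ 2 * (\<rho> + 1) ^ 2 * real L ^ 2"
    by (simp add: Let_def A_def \<rho>_def)
qed simp

end
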